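(* Let $X,Y$ be complex Banach spaces, let $0<\alpha<1$ and $0<\beta\le 1$, let $\varphi:\mathbb{D}\to\mathbb{D}$ be analytic and let $\psi:\mathbb{D}\to L(X,Y)$ be analytic. Then the weighted composition operator $W_{\psi,\varphi}$ maps $\Lambda_\alpha(X)$ boundedly into $\Lambda_\beta(Y)$ if and only if $\psi\in\Lambda_\beta(L(X,Y))$ and $$q_{\alpha,\beta}:=\sup_{z\in\mathbb{D}}\frac{(1-|z|^2)^{1-\beta}}{(1-|\varphi(z)|^2)^{1-\alpha}}\,|\varphi'(z)|\,\|\psi_z\|<\infty .$$ Moreover, in this case, $$\|W_{\psi,\varphi}:\Lambda_\alpha(X)\to\Lambda_\beta(Y)\|\asymp\max\{q_{\alpha,\beta},\ \|\psi\|_{\Lambda_\beta(L(X,Y))}\},$$ i.e. there are constants $a,b>0$, not depending on $\psi$ or $\varphi$, such that $a\,\|W_{\psi,\varphi}\|\le \max\{q_{\alpha,\beta},\|\psi\|_{\Lambda_\beta(L(X,Y))}\}\le b\,\|W_{\psi,\varphi}\|$.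
   Context: $\mathbb{D}$ is the open unit disk of $\mathbb{C}$. $L(X,Y)$ is the Banach space of bounded linear operators $X\to Y$ with the operator norm. For a complex Banach space $X$, $H(\mathbb{D},X)$ is the space of analytic functions $\mathbb{D}\to X$. For $\alpha\in(0,1]$, $\Lambda_\alpha(X)$ is the space of all $f\in H(\mathbb{D},X)$ with $p_\alpha(f)=\sup_{z\ne w\in\mathbb{D}}\|f(z)-f(w)\|/|z-w|^\alpha<\infty$. It is a Banach space under $\|f\|_\alpha=\sup_{z\in\mathbb{D}}\|f(z)\|+p_\alpha(f)$. For $\alpha\in(0,1)$ it is equipped with the equivalent norm $\|f\|_{\Lambda_\alpha(X)}=\|f(0)\|+\sup_{z\in\mathbb{D}}(1-|z|^2)^{1-\alpha}\|f'(z)\|$; for $\alpha=1$ it is equipped with $\|\cdot\|_1$. The same definitions apply with $X$ replaced by $Y$ or $L(X,Y)$ and $\alpha$ by $\beta$. Write $\psi_z=\psi(z)\in L(X,Y)$. The weighted composition operator is $W_{\psi,\varphi}(f)(z)=\psi_z(f(\varphi(z)))$, $z\in\mathbb{D}$, for $f:\mathbb{D}\to X$. *)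

theory Defs
  imports "HOL-Complex_Analysis.Complex_Analysis"
begin

section \<open>Complex Banach spaces\<close>

text \<open>The library has real Banach spaces only. A complex Banach space is a real Banach space
  together with a complex scalar multiplication that extends the real one and for which the
  norm is absolutely homogeneous.\<close>

class complex_banach = banach +
  fixes scaleC :: "complex \<Rightarrow> 'a \<Rightarrow> 'a" (infixr \<open>*\<^sub>C\<close> 75)
  assumes scaleR_scaleC: "r *\<^sub>R x = complex_of_real r *\<^sub>C x"
    and scaleC_add_right: "c *\<^sub>C (x + y) = c *\<^sub>C x + c *\<^sub>C y"
    and scaleC_add_left: "(c + d) *\<^sub>C x = c *\<^sub>C x + d *\<^sub>C x"
    and scaleC_scaleC: "c *\<^sub>C d *\<^sub>C x = (c * d) *\<^sub>C x"
    and norm_scaleC: "norm (c *\<^sub>C x) = cmod c * norm x"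

instantiation complex :: complex_banach
begin

definition scaleC_complex :: "complex \<Rightarrow> complex \<Rightarrow> complex"
  where "scaleC_complex c x = c * x"

instance
  by standard (simp_all add: scaleC_complex_def scaleR_conv_of_real algebra_simps norm_mult)

end

lemma bounded_linear_scaleC: "bounded_linear (\<lambda>x::'a::complex_banach. c *\<^sub>C x)"
proof (rule bounded_linear_intro[where K = "cmod c"])
  show "c *\<^sub>C (r *\<^sub>R x) = r *\<^sub>R (c *\<^sub>C x)" for r and x :: 'a
    by (simp add: scaleR_scaleC scaleC_scaleC mult.commute)
qed (simp_all add: scaleC_add_right norm_scaleC mult.commute)

lemma scaleC_one: "1 *\<^sub>C x = (x :: 'a::complex_banach)"
  by (metis of_real_1 scaleR_one scaleR_scaleC)

section \<open>The Banach space of bounded complex-linear operators\<close>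

typedef (overloaded) ('a, 'b) cblinfun =
    "{T :: 'a::complex_banach \<Rightarrow>\<^sub>L 'b::complex_banach.
        \<forall>c x. blinfun_apply T (c *\<^sub>C x) = c *\<^sub>C blinfun_apply T x}"
  morphisms blinfun_of_cblinfun cblinfun_of_blinfun
  by (rule exI[where x = 0])
    (simp add: bounded_linear.linear linear_0[OF bounded_linear.linear[OF bounded_linear_scaleC]])

type_notation cblinfun (\<open>(_ \<Rightarrow>\<^sub>C\<^sub>L /_)\<close> [22, 21] 21)

setup_lifting type_definition_cblinfun

lift_definition cblinfun_apply ::
    "('a::complex_banach \<Rightarrow>\<^sub>C\<^sub>L 'b::complex_banach) \<Rightarrow> 'a \<Rightarrow> 'b"
  is blinfun_apply .

text \<open>Addition, scalar multiplication, the norm (the operator norm) and the topology are those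
  of the ambient space of bounded real-linear operators.\<close>

instantiation cblinfun :: (complex_banach, complex_banach) real_normed_vector
begin

lift_definition zero_cblinfun :: "'a \<Rightarrow>\<^sub>C\<^sub>L 'b" is 0
  by (simp add: linear_0[OF bounded_linear.linear[OF bounded_linear_scaleC]])

lift_definition plus_cblinfun :: "('a \<Rightarrow>\<^sub>C\<^sub>L 'b) \<Rightarrow> ('a \<Rightarrow>\<^sub>C\<^sub>L 'b) \<Rightarrow> 'a \<Rightarrow>\<^sub>C\<^sub>L 'b" is "(+)"
  by (simp add: blinfun.add_left scaleC_add_right)

lift_definition minus_cblinfun :: "('a \<Rightarrow>\<^sub>C\<^sub>L 'b) \<Rightarrow> ('a \<Rightarrow>\<^sub>C\<^sub>L 'b) \<Rightarrow> 'a \<Rightarrow>\<^sub>C\<^sub>L 'b" is "(-)"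
  by (simp add: blinfun.diff_left linear_diff[OF bounded_linear.linear[OF bounded_linear_scaleC]])

lift_definition uminus_cblinfun :: "('a \<Rightarrow>\<^sub>C\<^sub>L 'b) \<Rightarrow> 'a \<Rightarrow>\<^sub>C\<^sub>L 'b" is uminus
  by (simp add: blinfun.minus_left linear_neg[OF bounded_linear.linear[OF bounded_linear_scaleC]])

lift_definition scaleR_cblinfun :: "real \<Rightarrow> ('a \<Rightarrow>\<^sub>C\<^sub>L 'b) \<Rightarrow> 'a \<Rightarrow>\<^sub>C\<^sub>L 'b" is scaleR
  by (simp add: blinfun.scaleR_left scaleR_scaleC scaleC_scaleC mult.commute)

lift_definition norm_cblinfun :: "('a \<Rightarrow>\<^sub>C\<^sub>L 'b) \<Rightarrow> real" is norm .

definition sgn_cblinfun :: "('a \<Rightarrow>\<^sub>C\<^sub>L 'b) \<Rightarrow> 'a \<Rightarrow>\<^sub>C\<^sub>L 'b"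
  where "sgn_cblinfun T = scaleR (inverse (norm T)) T"

definition dist_cblinfun :: "('a \<Rightarrow>\<^sub>C\<^sub>L 'b) \<Rightarrow> ('a \<Rightarrow>\<^sub>C\<^sub>L 'b) \<Rightarrow> real"
  where "dist_cblinfun S T = norm (S - T)"

definition
  "(uniformity :: (('a \<Rightarrow>\<^sub>C\<^sub>L 'b) \<times> ('a \<Rightarrow>\<^sub>C\<^sub>L 'b)) filter) =
     (INF e\<in>{0 <..}. principal {(x, y). dist x y < e})"

definition open_cblinfun :: "('a \<Rightarrow>\<^sub>C\<^sub>L 'b) set \<Rightarrow> bool"
  where "open_cblinfun S = (\<forall>x\<in>S. \<forall>\<^sub>F (x', y) in uniformity. x' = x \<longrightarrow> y \<in> S)"

instance
proof
  fix S T U :: "'a \<Rightarrow>\<^sub>C\<^sub>L 'b" and r s :: real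
  show "S + T + U = S + (T + U)" "S + T = T + S" "0 + S = S" "- S + S = 0" "S - T = S + - T"
    by (transfer, simp)+
  show "r *\<^sub>R (S + T) = r *\<^sub>R S + r *\<^sub>R T" "(r + s) *\<^sub>R S = r *\<^sub>R S + s *\<^sub>R S"
    "r *\<^sub>R s *\<^sub>R S = (r * s) *\<^sub>R S" "1 *\<^sub>R S = S"
    by (transfer, simp add: scaleR_right_distrib scaleR_left_distrib)+
  show "dist S T = norm (S - T)" by (rule dist_cblinfun_def)
  show "sgn S = scaleR (inverse (norm S)) S" by (rule sgn_cblinfun_def)
  show "norm (S + T) \<le> norm S + norm T" by transfer (rule norm_triangle_ineq)
  show "norm (r *\<^sub>R S) = \<bar>r\<bar> * norm S" "norm S = 0 \<longleftrightarrow> S = 0"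
    by (transfer, simp)+
qed (simp_all add: uniformity_cblinfun_def open_cblinfun_def)

end

lemma apply_scaleC_blinfun:
  "blinfun_apply (Blinfun (\<lambda>x. c *\<^sub>C blinfun_apply T x)) y = c *\<^sub>C blinfun_apply T y"
  for T :: "'a::real_normed_vector \<Rightarrow>\<^sub>L 'b::complex_banach"
proof -
  have "bounded_linear (\<lambda>x. c *\<^sub>C blinfun_apply T x)"
    by (rule bounded_linear_compose[OF bounded_linear_scaleC blinfun.bounded_linear_right])
  then show ?thesis
    by (simp add: bounded_linear_Blinfun_apply)
qed

instantiation cblinfun :: (complex_banach, complex_banach) complex_banach
begin

lift_definition scaleC_cblinfun :: "complex \<Rightarrow> ('a \<Rightarrow>\<^sub>C\<^sub>L 'b) \<Rightarrow> 'a \<Rightarrow>\<^sub>C\<^sub>L 'b"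
  is "\<lambda>c T. Blinfun (\<lambda>x. c *\<^sub>C blinfun_apply T x)"
  by (simp only: apply_scaleC_blinfun scaleC_scaleC mult.commute)

instance
proof
  show "convergent X" if "Cauchy X" for X :: "nat \<Rightarrow> 'a \<Rightarrow>\<^sub>C\<^sub>L 'b"
  proof -
    have dist_eq: "dist S T = dist (blinfun_of_cblinfun S) (blinfun_of_cblinfun T)"
      for S T :: "'a \<Rightarrow>\<^sub>C\<^sub>L 'b"
      unfolding dist_norm by transfer simp
    have "Cauchy (\<lambda>n. blinfun_of_cblinfun (X n))"
      using that unfolding Cauchy_def dist_eq .
    then obtain L where L: "(\<lambda>n. blinfun_of_cblinfun (X n)) \<longlonglongrightarrow> L"
      using Cauchy_convergent convergent_def by blast
    have "blinfun_apply L (c *\<^sub>C x) = c *\<^sub>C blinfun_apply L x" for c x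
    proof (rule LIMSEQ_unique)
      have lim: "(\<lambda>n. blinfun_apply (blinfun_of_cblinfun (X n)) y) \<longlonglongrightarrow> blinfun_apply L y" for y
        by (intro blinfun.tendsto L tendsto_const)
      show "(\<lambda>n. blinfun_apply (blinfun_of_cblinfun (X n)) (c *\<^sub>C x))
          \<longlonglongrightarrow> blinfun_apply L (c *\<^sub>C x)"
        by (rule lim)
      have "(\<lambda>n. c *\<^sub>C blinfun_apply (blinfun_of_cblinfun (X n)) x)
          \<longlonglongrightarrow> c *\<^sub>C blinfun_apply L x"
        by (rule bounded_linear.tendsto[OF bounded_linear_scaleC lim])
      then show "(\<lambda>n. blinfun_apply (blinfun_of_cblinfun (X n)) (c *\<^sub>C x))
          \<longlonglongrightarrow> c *\<^sub>C blinfun_apply L x"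
        by (simp add: blinfun_of_cblinfun[simplified])
    qed
    then have "blinfun_of_cblinfun (cblinfun_of_blinfun L) = L"
      by (simp add: cblinfun_of_blinfun_inverse)
    with L have "X \<longlonglongrightarrow> cblinfun_of_blinfun L"
      by (simp add: tendsto_iff dist_eq)
    then show ?thesis by (rule convergentI)
  qed
  fix S T :: "'a \<Rightarrow>\<^sub>C\<^sub>L 'b" and c d :: complex and r :: real
  show "r *\<^sub>R S = complex_of_real r *\<^sub>C S"
    by transfer (rule blinfun_eqI, simp only: apply_scaleC_blinfun, simp add: apply_scaleC_blinfun blinfun.scaleR_left scaleR_scaleC)
  show "c *\<^sub>C (S + T) = c *\<^sub>C S + c *\<^sub>C T"
    by transfer (rule blinfun_eqI, simp only: apply_scaleC_blinfun, simp add: apply_scaleC_blinfun blinfun.add_left scaleC_add_right)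
  show "(c + d) *\<^sub>C S = c *\<^sub>C S + d *\<^sub>C S"
    by transfer (rule blinfun_eqI, simp only: apply_scaleC_blinfun, simp add: apply_scaleC_blinfun blinfun.add_left scaleC_add_left)
  show "c *\<^sub>C d *\<^sub>C S = (c * d) *\<^sub>C S"
    by transfer (rule blinfun_eqI, simp only: apply_scaleC_blinfun, simp add: apply_scaleC_blinfun scaleC_scaleC)
  show "norm (c *\<^sub>C S) = cmod c * norm S"
  proof transfer
    fix c and S :: "'a \<Rightarrow>\<^sub>L 'b"
    have le: "norm (Blinfun (\<lambda>x. c *\<^sub>C blinfun_apply T x)) \<le> cmod c * norm T"
      for c and T :: "'a \<Rightarrow>\<^sub>L 'b"
      by (rule norm_blinfun_bound)
        (auto simp: apply_scaleC_blinfun norm_scaleC mult.assoc intro!: mult_left_mono norm_blinfun)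
    show "norm (Blinfun (\<lambda>x. c *\<^sub>C blinfun_apply S x)) = cmod c * norm S"
    proof (cases "c = 0")
      case True
      then show ?thesis
        using le[of c S] by simp
    next
      case False
      define T where "T = Blinfun (\<lambda>x. c *\<^sub>C blinfun_apply S x)"
      have "S = Blinfun (\<lambda>x. inverse c *\<^sub>C blinfun_apply T x)"
        using False
        by (intro blinfun_eqI) (simp add: T_def apply_scaleC_blinfun scaleC_scaleC scaleC_one blinfun_apply_inverse)
      then have "norm S \<le> cmod (inverse c) * norm T"
        using le by metis
      then have "cmod c * norm S \<le> norm T"
        using False by (simp only: norm_inverse) (simp add: divide_simps mult.commute)
      with le[of c S] show ?thesis
        by (simp add: T_def)
    qed
  qed
qed

end

section \<open>Vector-valued analytic functions and Lipschitz spaces on the disk\<close>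

abbreviation unit_disk :: "complex set" (\<open>\<bbbD>\<close>)
  where "\<bbbD> \<equiv> ball 0 1"

definition has_complex_derivative ::
    "(complex \<Rightarrow> 'a::complex_banach) \<Rightarrow> 'a \<Rightarrow> complex \<Rightarrow> bool"
  where "has_complex_derivative f D z \<longleftrightarrow> (f has_derivative (\<lambda>h. h *\<^sub>C D)) (at z)"

definition complex_derivative :: "(complex \<Rightarrow> 'a::complex_banach) \<Rightarrow> complex \<Rightarrow> 'a"
  where "complex_derivative f z = (THE D. has_complex_derivative f D z)"

text \<open>Elements of the function spaces are total functions on \<^typ>\<open>complex\<close>; only their values on the
  disk matter.\<close>

definition analytic_disk :: "(complex \<Rightarrow> 'a::complex_banach) set"
  where "analytic_disk = {f. \<forall>z\<in>\<bbbD>. \<exists>D. has_complex_derivative f D z}"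

text \<open>Suprema are taken in the extended nonnegative reals, so that they are meaningful without
  any boundedness assumption.\<close>

definition lip_seminorm :: "real \<Rightarrow> (complex \<Rightarrow> 'a::complex_banach) \<Rightarrow> ennreal"
  where "lip_seminorm \<alpha> f =
    (SUP (z, w) \<in> {(z, w). z \<in> \<bbbD> \<and> w \<in> \<bbbD> \<and> z \<noteq> w}.
       ennreal (norm (f z - f w) / cmod (z - w) powr \<alpha>))"

definition Lip :: "real \<Rightarrow> (complex \<Rightarrow> 'a::complex_banach) set"
  where "Lip \<alpha> = {f \<in> analytic_disk. lip_seminorm \<alpha> f < \<infinity>}"

text \<open>For exponents below 1 the space carries the norm given by the growth of the derivative, which
  is equivalent to the sup norm plus the Lipschitz seminorm; the latter is used only for exponent 1.\<close>

definition Lip_norm :: "real \<Rightarrow> (complex \<Rightarrow> 'a::complex_banach) \<Rightarrow> ennreal"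
  where "Lip_norm \<alpha> f =
    (if \<alpha> < 1
     then ennreal (norm (f 0)) +
       (SUP z\<in>\<bbbD>. ennreal ((1 - (cmod z)\<^sup>2) powr (1 - \<alpha>) * norm (complex_derivative f z)))
     else (SUP z\<in>\<bbbD>. ennreal (norm (f z))) + lip_seminorm \<alpha> f)"

section \<open>Weighted composition operators\<close>

definition weighted_comp ::
    "(complex \<Rightarrow> ('a::complex_banach \<Rightarrow>\<^sub>C\<^sub>L 'b::complex_banach)) \<Rightarrow> (complex \<Rightarrow> complex)
      \<Rightarrow> (complex \<Rightarrow> 'a) \<Rightarrow> complex \<Rightarrow> 'b"
  where "weighted_comp \<psi> \<phi> f z = cblinfun_apply (\<psi> z) (f (\<phi> z))"

definition maps_Lip_boundedly ::
    "real \<Rightarrow> real \<Rightarrow> ((complex \<Rightarrow> 'a::complex_banach) \<Rightarrow> complex \<Rightarrow> 'b::complex_banach) \<Rightarrow> bool"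
  where "maps_Lip_boundedly \<alpha> \<beta> W \<longleftrightarrow>
    (\<forall>f\<in>Lip \<alpha>. W f \<in> Lip \<beta>) \<and>
    (\<exists>C\<ge>0. \<forall>f\<in>Lip \<alpha>. Lip_norm \<beta> (W f) \<le> ennreal C * Lip_norm \<alpha> f)"

definition Lip_opnorm ::
    "real \<Rightarrow> real \<Rightarrow> ((complex \<Rightarrow> 'a::complex_banach) \<Rightarrow> complex \<Rightarrow> 'b::complex_banach) \<Rightarrow> ennreal"
  where "Lip_opnorm \<alpha> \<beta> W = (SUP f\<in>{f \<in> Lip \<alpha>. Lip_norm \<alpha> f \<le> 1}. Lip_norm \<beta> (W f))"

definition q_quantity ::
    "real \<Rightarrow> real \<Rightarrow> (complex \<Rightarrow> ('a::complex_banach \<Rightarrow>\<^sub>C\<^sub>L 'b::complex_banach))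
      \<Rightarrow> (complex \<Rightarrow> complex) \<Rightarrow> ennreal"
  where "q_quantity \<alpha> \<beta> \<psi> \<phi> =
    (SUP z\<in>\<bbbD>. ennreal ((1 - (cmod z)\<^sup>2) powr (1 - \<beta>) / (1 - (cmod (\<phi> z))\<^sup>2) powr (1 - \<alpha>)
                    * cmod (deriv \<phi> z) * norm (\<psi> z)))"

end

theory Submission
  imports Defs
begin

text \<open>
  For \<open>0 < \<alpha> \<le> 1\<close> an analytic function \<open>f\<close> on the disk is Hoelder continuous of order \<open>\<alpha>\<close> if and only if
  \<open>(1 - \<bar>z\<bar>^2)^(1 - \<alpha>) \<parallel>f' z\<parallel>\<close> is bounded (Hardy and Littlewood), with comparable constants:
  \<open>derivative_growth_imp_Hoelder\<close> and \<open>Hoelder_imp_derivative_growth\<close>. Hence, for every exponent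
  including 1, the norm of the Lipschitz space is comparable to the sup norm together with this
  bound (\<open>Lip_norm_le\<close>, \<open>Lip_norm_leD\<close>), and the theorem becomes a statement about the size
  of \<open>W f\<close> and of
  \<open>(W f)' z = \<psi>' z (f (\<phi> z)) + \<phi>' z \<psi>\<^sub>z (f' (\<phi> z))\<close>.

  If \<open>\<psi>\<close> lies in the Lipschitz space and \<open>q\<close> is finite, both terms are bounded as required
  (\<open>weighted_comp_Lip_norm_le\<close>): the functions in the domain are bounded since
  \<open>(1 - t)^(\<alpha> - 1)\<close> is integrable, and \<open>q\<close> is exactly the factor that turns the growth condition for
  \<open>f'\<close> at \<open>\<phi> z\<close> into the one for the second term at \<open>z\<close>.

  Conversely (\<open>weighted_comp_bounded_imp\<close>), the constant functions \<open>x\<close> kill the second term and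
  yield the norm of \<open>\<psi>\<close>. To isolate the second term at \<open>z\<close>, with \<open>a = \<phi> z\<close>, one uses the primitive of
  \<open>(1 - cnj a w)^(\<alpha> - 1)\<close> that vanishes at \<open>a\<close>, times \<open>x\<close> (\<open>peak_function_in_unit_ball\<close>). It kills the
  first term at \<open>z\<close>, its derivative at \<open>a\<close> is \<open>(1 - \<bar>a\<bar>^2)^(\<alpha> - 1) x\<close>, and its norm is bounded
  independently of \<open>a\<close>. The constants of both directions depend on the exponents only.

  The passage from Hoelder continuity to the growth of the derivative rests on a Cauchy estimate
  (\<open>norm_complex_derivative_le_Cauchy\<close>). For functions with values in a Banach space it is reduced to
  the scalar one by a functional of norm at most one that attains the norm of a given vector
  (\<open>complex_norming_functional\<close>). Its existence is the Hahn--Banach theorem, obtained here from the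
  fact that the minimal sublinear functionals are linear.
\<close>

section \<open>Norming functionals\<close>

text \<open>Only the inequality \<open>p (c x) \<le> c p x\<close> is demanded, since inequalities pass to
  pointwise infima; equality for \<open>c \<ge> 0\<close> follows.\<close>
definition sublinear :: "('a::real_vector \<Rightarrow> real) \<Rightarrow> bool"
  where "sublinear p \<longleftrightarrow>
    (\<forall>x y. p (x + y) \<le> p x + p y) \<and> (\<forall>c\<ge>0. \<forall>x. p (c *\<^sub>R x) \<le> c * p x)"

lemma sublinearI:
  assumes "\<And>x y. p (x + y) \<le> p x + p y" and "\<And>c x. 0 \<le> c \<Longrightarrow> p (c *\<^sub>R x) \<le> c * p x"
  shows "sublinear p"
  using assms by (simp add: sublinear_def)

lemma sublinear_add: "sublinear p \<Longrightarrow> p (x + y) \<le> p x + p y"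
  by (simp add: sublinear_def)

lemma sublinear_scaleR:
  assumes p: "sublinear p" and c: "0 \<le> c"
  shows "p (c *\<^sub>R x) = c * p x"
proof (rule antisym)
  have le: "p (d *\<^sub>R y) \<le> d * p y" if "0 \<le> d" for d y
    using p that by (simp add: sublinear_def)
  show "p (c *\<^sub>R x) \<le> c * p x"
    using le c .
  show "c * p x \<le> p (c *\<^sub>R x)"
  proof (cases "c = 0")
    case True
    then show ?thesis
      using sublinear_add[OF p, of 0 0] by simp
  next
    case False
    then show ?thesis
      using le[of "inverse c" "c *\<^sub>R x"] c by (simp add: field_simps)
  qed
qed

lemma sublinear_0: "sublinear p \<Longrightarrow> p 0 = 0"
  using sublinear_scaleR[of p 0 0] by simp

lemma sublinear_minus_le: "sublinear p \<Longrightarrow> - p (- x) \<le> p x"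
  using sublinear_add[of p x "- x"] sublinear_0[of p] by simp

text \<open>Both infima used below, over a chain and over the translates of one functional, are
  infima of families that are only jointly sublinear in this sense.\<close>
lemma sublinear_INF:
  fixes F :: "('a::real_vector \<Rightarrow> real) set"
  assumes ne: "F \<noteq> {}"
    and bdd: "\<And>x. bdd_below ((\<lambda>p. p x) ` F)"
    and add: "\<And>p q. p \<in> F \<Longrightarrow> q \<in> F \<Longrightarrow> \<exists>r\<in>F. \<forall>x y. r (x + y) \<le> p x + q y"
    and scale: "\<And>p c. p \<in> F \<Longrightarrow> 0 \<le> c \<Longrightarrow> \<exists>r\<in>F. \<forall>x. r (c *\<^sub>R x) \<le> c * p x"
  shows "sublinear (\<lambda>x. INF p\<in>F. p x)"
proof (rule sublinearI)
  let ?u = "\<lambda>x. INF p\<in>F. p x"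
  have lower: "?u x \<le> p x" if "p \<in> F" for p x
    by (rule cINF_lower[OF bdd that])
  show "?u (x + y) \<le> ?u x + ?u y" for x y
  proof -
    have *: "?u (x + y) \<le> p x + q y" if "p \<in> F" "q \<in> F" for p q
      using add[OF that] lower by (meson order_trans)
    have "?u (x + y) - q y \<le> ?u x" if "q \<in> F" for q
      by (rule cINF_greatest[OF ne]) (use *[OF _ that] in \<open>simp add: algebra_simps\<close>)
    then have "?u (x + y) - ?u x \<le> ?u y"
      by (intro cINF_greatest[OF ne]) (simp add: algebra_simps)
    then show ?thesis by simp
  qed
  show "?u (c *\<^sub>R x) \<le> c * ?u x" if c: "0 \<le> c" for c x
  proof -
    have *: "?u (c *\<^sub>R x) \<le> c * p x" if "p \<in> F" for p
      using scale[OF that c] lower by (meson order_trans)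
    show ?thesis
    proof (cases "c = 0")
      case True
      then show ?thesis using * ne by auto
    next
      case False
      then have "?u (c *\<^sub>R x) / c \<le> ?u x"
        using c * by (intro cINF_greatest[OF ne]) (simp add: field_simps)
      then show ?thesis using False c by (simp add: field_simps)
    qed
  qed
qed

text \<open>The functional \<open>x \<mapsto> inf {p (x + t v) - t p v | t \<ge> 0}\<close> lies below \<open>p\<close> (take \<open>t = 0\<close>) and,
  by \<open>t = 1\<close>, is at most \<open>- p v\<close> at \<open>- v\<close>. It serves twice: applied to the norm it forces the value
  \<open>\<parallel>v\<parallel>\<close> at \<open>v\<close> on every linear functional below it, and applied to a minimal functional it shows
  that this functional is odd.\<close>
lemma sublinear_tilt:
  fixes p :: "'a::real_vector \<Rightarrow> real"
  assumes p: "sublinear p"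
  shows "\<exists>q. sublinear q \<and> q \<le> p \<and> q (- v) \<le> - p v"
proof -
  define F where "F = (\<lambda>t x. p (x + t *\<^sub>R v) - t * p v) ` {0..}"
  define q where "q = (\<lambda>x. INF f\<in>F. f x)"
  have bdd: "bdd_below ((\<lambda>f. f x) ` F)" for x
  proof (rule bdd_belowI2)
    fix f assume "f \<in> F"
    then obtain t where t: "0 \<le> t" "f = (\<lambda>x. p (x + t *\<^sub>R v) - t * p v)"
      by (auto simp: F_def)
    have "t * p v = p ((x + t *\<^sub>R v) + - x)"
      using sublinear_scaleR[OF p t(1)] by simp
    also have "\<dots> \<le> p (x + t *\<^sub>R v) + p (- x)"
      by (rule sublinear_add[OF p])
    finally show "- p (- x) \<le> f x" using t by simp
  qed
  have sub: "sublinear q"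
    unfolding q_def
  proof (rule sublinear_INF[OF _ bdd])
    show "F \<noteq> {}" by (auto simp: F_def)
  next
    fix f g assume "f \<in> F" "g \<in> F"
    then obtain s t where s: "0 \<le> s" "f = (\<lambda>x. p (x + s *\<^sub>R v) - s * p v)"
      and t: "0 \<le> t" "g = (\<lambda>x. p (x + t *\<^sub>R v) - t * p v)"
      by (auto simp: F_def)
    have "p (x + y + (s + t) *\<^sub>R v) - (s + t) * p v \<le> f x + g y" for x y
      using sublinear_add[OF p, of "x + s *\<^sub>R v" "y + t *\<^sub>R v"]
      by (simp add: s(2) t(2) algebra_simps)
    with s(1) t(1) show "\<exists>r\<in>F. \<forall>x y. r (x + y) \<le> f x + g y"
      by (auto simp: F_def intro!: bexI[of _ "s + t"])
  next
    fix f c assume "f \<in> F" and c: "(0::real) \<le> c"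
    then obtain s where s: "0 \<le> s" "f = (\<lambda>x. p (x + s *\<^sub>R v) - s * p v)"
      by (auto simp: F_def)
    have "p (c *\<^sub>R x + (c * s) *\<^sub>R v) - (c * s) * p v = c * f x" for x
      using sublinear_scaleR[OF p c, of "x + s *\<^sub>R v"] by (simp add: s(2) algebra_simps)
    with s(1) c show "\<exists>r\<in>F. \<forall>x. r (c *\<^sub>R x) \<le> c * f x"
      by (auto simp: F_def intro!: bexI[of _ "c * s"])
  qed
  have le: "q x \<le> p (x + t *\<^sub>R v) - t * p v" if "0 \<le> t" for x t
    unfolding q_def by (rule cINF_lower[OF bdd, THEN order_trans]) (use that in \<open>auto simp: F_def\<close>)
  have "q (- v) \<le> - p v" using le[of 1 "- v"] sublinear_0[OF p] by simp
  moreover have "q \<le> p" using le[of 0] by (simp add: le_fun_def)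
  ultimately show ?thesis using sub by blast
qed

text \<open>Zorn's lemma applies because a chain of sublinear functionals below \<open>p\<close> is bounded below
  at each \<open>x\<close> by \<open>- p (- x)\<close>, so that its pointwise infimum is again sublinear.\<close>
lemma minimal_sublinear:
  fixes p :: "'a::real_vector \<Rightarrow> real"
  assumes p: "sublinear p"
  shows "\<exists>m. sublinear m \<and> m \<le> p \<and> (\<forall>q. sublinear q \<longrightarrow> q \<le> m \<longrightarrow> q = m)"
proof -
  define A where "A = {q. sublinear q \<and> q \<le> p}"
  have "\<exists>m\<in>A. \<forall>q\<in>A. q \<le> m \<longrightarrow> q = m"
  proof (rule predicate_Zorn[where P = "\<lambda>f g. g \<le> f"])
    show "partial_order_on A (relation_of (\<lambda>f g. g \<le> f) A)"
      by (rule partial_order_on_relation_ofI) auto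
  next
    fix C assume C: "C \<in> Chains (relation_of (\<lambda>f g. g \<le> f) A)"
    show "\<exists>u\<in>A. \<forall>q\<in>C. u \<le> q"
    proof (cases "C = {}")
      case True
      then show ?thesis using p by (auto simp: A_def)
    next
      case False
      have tot: "f \<le> g \<or> g \<le> f" if "f \<in> C" "g \<in> C" for f g
        using C that by (auto simp: Chains_def relation_of_def)
      have CA: "sublinear q \<and> q \<le> p" if "q \<in> C" for q
        using C that by (auto simp: Chains_def relation_of_def A_def)
      have bdd: "bdd_below ((\<lambda>f. f x) ` C)" for x
      proof (rule bdd_belowI2)
        fix q assume "q \<in> C"
        then have "sublinear q" "q (- x) \<le> p (- x)" using CA by (auto simp: le_fun_def)
        then show "- p (- x) \<le> q x" using sublinear_minus_le[of q x] by linarith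
      qed
      define u where "u = (\<lambda>x. INF f\<in>C. f x)"
      have lower: "u \<le> q" if "q \<in> C" for q
        using cINF_lower[OF bdd that] by (simp add: u_def le_fun_def)
      have "sublinear u"
        unfolding u_def
      proof (rule sublinear_INF[OF False bdd])
        fix f g assume fg: "f \<in> C" "g \<in> C"
        show "\<exists>r\<in>C. \<forall>x y. r (x + y) \<le> f x + g y"
        proof (cases "f \<le> g")
          case True
          then have "f (x + y) \<le> f x + g y" for x y
            using sublinear_add[of f x y] CA[OF fg(1)] le_funD[OF True, of y] by linarith
          then show ?thesis using fg by blast
        next
          case False
          then have "g \<le> f" using tot fg by blast
          then have "g (x + y) \<le> f x + g y" for x y
            using sublinear_add[of g x y] CA[OF fg(2)] le_funD[of g f x] by linarith
          then show ?thesis using fg by blast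
        qed
      next
        fix f c assume "f \<in> C" "(0::real) \<le> c"
        then show "\<exists>r\<in>C. \<forall>x. r (c *\<^sub>R x) \<le> c * f x"
          using CA sublinear_scaleR by (metis order_refl)
      qed
      moreover have "u \<le> p" using False lower CA by (metis all_not_in_conv order_trans)
      ultimately show ?thesis using lower by (auto simp: A_def)
    qed
  qed
  then show ?thesis by (auto simp: A_def intro: order_trans)
qed

text \<open>A minimal functional equals each of its own tilts, hence \<open>m (- x) \<le> - m x\<close>; an odd
  sublinear functional is additive and homogeneous.\<close>
lemma minimal_sublinear_linear:
  fixes m :: "'a::real_vector \<Rightarrow> real"
  assumes m: "sublinear m" and min: "\<And>q. sublinear q \<Longrightarrow> q \<le> m \<Longrightarrow> q = m"
  shows "linear m"
proof -
  have minus: "m (- x) = - m x" for x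
  proof -
    obtain q where q: "sublinear q" "q \<le> m" "q (- x) \<le> - m x"
      using sublinear_tilt[OF m] by blast
    then have "m (- x) \<le> - m x" using min by blast
    then show ?thesis using sublinear_minus_le[OF m, of x] by simp
  qed
  show ?thesis
  proof
    fix x y
    have "m (- x + - y) \<le> m (- x) + m (- y)" by (rule sublinear_add[OF m])
    then have "m x + m y \<le> m (x + y)" using minus[of "x + y"] by (simp add: minus)
    then show "m (x + y) = m x + m y" using sublinear_add[OF m, of x y] by simp
  next
    fix c x
    show "m (c *\<^sub>R x) = c *\<^sub>R m x"
    proof (cases "0 \<le> c")
      case True
      then show ?thesis by (simp add: sublinear_scaleR[OF m])
    next
      case False
      then show ?thesis
        using sublinear_scaleR[OF m, of "- c" x] minus[of "c *\<^sub>R x"] by simp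
    qed
  qed
qed

lemma real_norming_functional:
  fixes v :: "'a::real_normed_vector"
  shows "\<exists>L. linear L \<and> (\<forall>x. \<bar>L x\<bar> \<le> norm x) \<and> L v = norm v"
proof -
  have "sublinear (norm :: 'a \<Rightarrow> real)"
    by (rule sublinearI) (simp_all add: norm_triangle_ineq)
  from sublinear_tilt[OF this, of v] obtain p :: "'a \<Rightarrow> real"
    where p: "sublinear p" "p \<le> norm" "p (- v) \<le> - norm v" by blast
  obtain L where L: "sublinear L" "L \<le> p" "\<And>q. sublinear q \<Longrightarrow> q \<le> L \<Longrightarrow> q = L"
    using minimal_sublinear[OF p(1)] by blast
  have lin: "linear L" by (rule minimal_sublinear_linear[OF L(1,3)])
  have le: "L x \<le> norm x" for x
    using L(2) p(2) by (meson le_funD order_trans)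
  have "\<bar>L x\<bar> \<le> norm x" for x
    using le[of x] le[of "- x"] linear_neg[OF lin, of x] by simp
  moreover have "norm v \<le> L v"
    using le_funD[OF L(2), of "- v"] p(3) linear_neg[OF lin, of v] by simp
  ultimately show ?thesis using lin le[of v] by (intro exI[of _ L]) auto
qed

lemma scaleC_0_left: "0 *\<^sub>C x = (0 :: 'a::complex_banach)"
  by (metis norm_eq_zero norm_scaleC mult_zero_left norm_zero)

lemma scaleC_0_right: "c *\<^sub>C 0 = (0 :: 'a::complex_banach)"
  by (metis norm_eq_zero norm_scaleC mult_zero_right norm_zero)

lemma scaleC_minus1: "(- 1) *\<^sub>C x = - (x :: 'a::complex_banach)"
  by (metis of_real_1 of_real_minus scaleR_minus1_left scaleR_scaleC)

text \<open>The real functional \<open>L\<close> is the real part of the complex one \<open>l x = L x - i L (i x)\<close>. The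
  bound by the norm survives because \<open>l x\<close> can be rotated onto the positive real axis, where \<open>l\<close>
  and \<open>L\<close> agree.\<close>
lemma complex_norming_functional:
  fixes v :: "'a::complex_banach"
  shows "\<exists>l. bounded_linear l \<and> (\<forall>c x. l (c *\<^sub>C x) = c * l x) \<and>
    (\<forall>x. cmod (l x) \<le> norm x) \<and> cmod (l v) = norm v"
proof -
  obtain L where lin: "linear L" and le: "\<And>x::'a. \<bar>L x\<bar> \<le> norm x" and Lv: "L v = norm v"
    using real_norming_functional by blast
  define l where "l = (\<lambda>x. Complex (L x) (- L (\<i> *\<^sub>C x)))"
  have decomp: "c *\<^sub>C x = Re c *\<^sub>R x + Im c *\<^sub>R (\<i> *\<^sub>C x)" for c and x :: 'a
    unfolding scaleR_scaleC scaleC_scaleC scaleC_add_left[symmetric]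
    by (metis complex_eq mult.commute)
  have hom: "l (c *\<^sub>C x) = c * l x" for c x
  proof -
    have ii: "\<i> *\<^sub>C \<i> *\<^sub>C x = - x" by (simp add: scaleC_scaleC scaleC_minus1)
    have 1: "L (c *\<^sub>C x) = Re c * L x + Im c * L (\<i> *\<^sub>C x)"
      by (subst decomp) (simp add: linear_add[OF lin] linear_scale[OF lin])
    have "\<i> *\<^sub>C c *\<^sub>C x = c *\<^sub>C \<i> *\<^sub>C x" by (simp add: scaleC_scaleC mult.commute)
    then have 2: "L (\<i> *\<^sub>C c *\<^sub>C x) = Re c * L (\<i> *\<^sub>C x) - Im c * L x"
      using decomp[of c "\<i> *\<^sub>C x"]
      by (simp add: ii linear_add[OF lin] linear_diff[OF lin] linear_scale[OF lin])
    show ?thesis by (rule complex_eqI) (simp_all add: l_def 1 2)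
  qed
  have bound: "cmod (l x) \<le> norm x" for x
  proof -
    define c where "c = cnj (sgn (l x))"
    have c1: "cmod c \<le> 1"
      by (simp add: c_def norm_sgn)
    have c2: "c * l x = complex_of_real (cmod (l x))"
    proof (cases "l x = 0")
      case False
      have "c * l x = (cnj (l x) * l x) / complex_of_real (cmod (l x))"
        by (simp add: c_def sgn_eq)
      also have "cnj (l x) * l x = complex_of_real (cmod (l x)) * complex_of_real (cmod (l x))"
        by (metis complex_norm_square mult.commute of_real_power power2_eq_square)
      finally show ?thesis using False by simp
    qed simp
    have "cmod (l x) = L (c *\<^sub>C x)"
      using c2 hom[of c x] by (simp add: l_def complex_eq_iff)
    also have "\<dots> \<le> cmod c * norm x" using le[of "c *\<^sub>C x"] by (simp add: norm_scaleC)
    also have "\<dots> \<le> norm x" using c1 by (simp add: mult_left_le_one_le)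
    finally show ?thesis .
  qed
  have "bounded_linear l"
  proof (rule bounded_linear_intro[where K = 1])
    show "l (x + y) = l x + l y" for x y
      by (simp add: l_def scaleC_add_right linear_add[OF lin] complex_eq_iff)
    show "l (r *\<^sub>R x) = r *\<^sub>R l x" for r x
      by (simp add: scaleR_scaleC[of r x] hom scaleR_conv_of_real)
  qed (simp add: bound)
  moreover have "cmod (l v) = norm v"
    using bound[of v] abs_Re_le_cmod[of "l v"] by (simp add: l_def Lv)
  ultimately show ?thesis using hom bound by blast
qed

section \<open>Vector-valued complex derivatives\<close>

lemma bounded_bilinear_scaleC: "bounded_bilinear (\<lambda>c (x::'a::complex_banach). c *\<^sub>C x)"
proof
  show "\<exists>K. \<forall>c (x::'a). norm (c *\<^sub>C x) \<le> norm c * norm x * K"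
    by (rule exI[of _ 1]) (simp add: norm_scaleC)
qed (simp_all add: scaleC_add_left scaleC_add_right scaleR_scaleC scaleC_scaleC
      scaleC_complex_def mult.commute)

lemmas bounded_linear_scaleC_left = bounded_bilinear.bounded_linear_left[OF bounded_bilinear_scaleC]

lemma has_complex_derivative_unique:
  assumes "has_complex_derivative f D z" "has_complex_derivative f E z"
  shows "D = E"
proof -
  have "(\<lambda>h. h *\<^sub>C D) = (\<lambda>h. h *\<^sub>C E)"
    using assms unfolding has_complex_derivative_def by (rule has_derivative_unique)
  then show ?thesis by (metis scaleC_one)
qed

lemma complex_derivative_eqI: "has_complex_derivative f D z \<Longrightarrow> complex_derivative f z = D"
  unfolding complex_derivative_def by (blast intro: has_complex_derivative_unique)

lemma analytic_disk_has_derivative: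
  assumes "f \<in> analytic_disk" "z \<in> \<bbbD>"
  shows "has_complex_derivative f (complex_derivative f z) z"
  using assms complex_derivative_eqI unfolding analytic_disk_def by blast

lemma analytic_diskI: "(\<And>z. z \<in> \<bbbD> \<Longrightarrow> has_complex_derivative f (D z) z) \<Longrightarrow> f \<in> analytic_disk"
  unfolding analytic_disk_def by blast

lemma has_complex_derivative_scalar_iff:
  "has_complex_derivative f D z \<longleftrightarrow> (f has_field_derivative D) (at z)"
  by (simp add: has_complex_derivative_def has_field_derivative_def scaleC_complex_def
      mult_commute_abs)

lemma has_complex_derivative_const: "has_complex_derivative (\<lambda>_. x) 0 z"
  by (simp add: has_complex_derivative_def scaleC_0_right)

lemma analytic_disk_convex_bound:
  assumes f: "f \<in> analytic_disk" and S: "convex S" "S \<subseteq> \<bbbD>"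
    and B: "\<And>z. z \<in> S \<Longrightarrow> norm (complex_derivative f z) \<le> B"
    and z: "z \<in> S" and w: "w \<in> S"
  shows "norm (f z - f w) \<le> B * cmod (z - w)"
proof (rule differentiable_bound[OF S(1) _ _ z w])
  fix u assume u: "u \<in> S"
  show "(f has_derivative (\<lambda>h. h *\<^sub>C complex_derivative f u)) (at u within S)"
    using analytic_disk_has_derivative[OF f] u S(2)
    unfolding has_complex_derivative_def by (blast intro: has_derivative_at_withinI)
  show "onorm (\<lambda>h. h *\<^sub>C complex_derivative f u) \<le> B"
    using B[OF u] order_trans[OF norm_ge_zero B[OF u]]
    by (intro onorm_bound) (auto simp: norm_scaleC mult.commute[of B] intro!: mult_left_mono)
qed

section \<open>Growth of the derivative and Hoelder continuity\<close>

definition derivative_growth :: "real \<Rightarrow> (complex \<Rightarrow> 'a::complex_banach) \<Rightarrow> real \<Rightarrow> bool"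
  where "derivative_growth \<alpha> f M \<longleftrightarrow>
    (\<forall>z\<in>\<bbbD>. (1 - (cmod z)\<^sup>2) powr (1 - \<alpha>) * norm (complex_derivative f z) \<le> M)"

lemma one_minus_norm_sq:
  assumes "z \<in> \<bbbD>"
  shows "0 < 1 - cmod z" and "1 - cmod z \<le> 1 - (cmod z)\<^sup>2" and "1 - (cmod z)\<^sup>2 \<le> 2 * (1 - cmod z)"
    and "0 < 1 - (cmod z)\<^sup>2"
proof -
  show 0: "0 < 1 - cmod z" using assms by simp
  have "(cmod z)\<^sup>2 \<le> cmod z" using 0 by (simp add: power2_eq_square mult_left_le_one_le)
  then show "1 - cmod z \<le> 1 - (cmod z)\<^sup>2" by simp
  with 0 show "0 < 1 - (cmod z)\<^sup>2" by linarith
  have "0 \<le> (1 - cmod z)\<^sup>2" by simp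
  then show "1 - (cmod z)\<^sup>2 \<le> 2 * (1 - cmod z)" by (simp add: power2_eq_square algebra_simps)
qed

lemma derivative_growth_nonneg: "derivative_growth \<alpha> f M \<Longrightarrow> 0 \<le> M"
  unfolding derivative_growth_def
  by (metis (no_types, lifting) centre_in_ball mult_nonneg_nonneg norm_ge_zero order_trans
      powr_ge_zero zero_less_one)

lemma derivative_growth_mono: "derivative_growth \<alpha> f M \<Longrightarrow> M \<le> N \<Longrightarrow> derivative_growth \<alpha> f N"
  unfolding derivative_growth_def by (meson order_trans)

lemma derivative_growth_bound:
  assumes g: "derivative_growth \<alpha> f M" and \<alpha>: "\<alpha> \<le> 1" and z: "z \<in> \<bbbD>" and s: "0 < s" "s \<le> 1 - cmod z"
  shows "norm (complex_derivative f z) \<le> M * s powr (\<alpha> - 1)"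
proof -
  have "s powr (1 - \<alpha>) * norm (complex_derivative f z)
      \<le> (1 - (cmod z)\<^sup>2) powr (1 - \<alpha>) * norm (complex_derivative f z)"
    using s one_minus_norm_sq[OF z] \<alpha> by (intro mult_right_mono powr_mono2) auto
  also have "\<dots> \<le> M" using g z by (auto simp: derivative_growth_def)
  finally have *: "s powr (1 - \<alpha>) * norm (complex_derivative f z) \<le> M" .
  have "norm (complex_derivative f z)
      = (s powr (1 - \<alpha>) * norm (complex_derivative f z)) * s powr (\<alpha> - 1)"
    using s by (simp add: mult.commute mult.left_commute flip: powr_add)
  also have "\<dots> \<le> M * s powr (\<alpha> - 1)"
    by (rule mult_right_mono[OF *]) simp
  finally show ?thesis .
qed

text \<open>Along the radius through \<open>z\<close> the growth condition bounds the derivative at \<open>t z\<close> by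
  \<open>M (1 - t)^(\<alpha> - 1)\<close>, which has the primitive \<open>- (M / \<alpha>) (1 - t)^\<alpha>\<close>. This primitive is continuous
  up to \<open>t = 1\<close>, so that the mean value inequality gives an increment that does not depend on
  how close \<open>z\<close> is to the boundary.\<close>
lemma radial_increment_le:
  assumes f: "f \<in> analytic_disk" and g: "derivative_growth \<alpha> f M" and \<alpha>: "0 < \<alpha>" "\<alpha> \<le> 1"
    and z: "z \<in> \<bbbD>" and \<rho>: "0 \<le> \<rho>" "\<rho> < 1"
  shows "norm (f z - f (\<rho> *\<^sub>R z)) \<le> M / \<alpha> * (1 - \<rho>) powr \<alpha>"
proof -
  have tz: "t *\<^sub>R z \<in> \<bbbD>" if "0 \<le> t" "t \<le> 1" for t
    using z that mult_left_le_one_le[of "cmod z" t] by simp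
  define F where "F = (\<lambda>t. f (t *\<^sub>R z))"
  define \<Phi> where "\<Phi> = (\<lambda>t. - (M / \<alpha>) * (1 - t) powr \<alpha>)"
  have der: "(F has_vector_derivative z *\<^sub>C complex_derivative f (t *\<^sub>R z)) (at t)"
    if "0 \<le> t" "t \<le> 1" for t
  proof -
    have 1: "((\<lambda>t. t *\<^sub>R z) has_derivative (\<lambda>h. h *\<^sub>R z)) (at t)"
      by (auto intro!: derivative_eq_intros)
    have 2: "(f has_derivative (\<lambda>h. h *\<^sub>C complex_derivative f (t *\<^sub>R z))) (at (t *\<^sub>R z))"
      using analytic_disk_has_derivative[OF f tz[OF that]] by (simp add: has_complex_derivative_def)
    from has_derivative_compose[OF 1 2] show ?thesis
      by (simp add: F_def has_vector_derivative_def scaleR_scaleC scaleC_scaleC scaleC_complex_def)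
  qed
  have "norm (F 1 - F \<rho>) \<le> \<Phi> 1 - \<Phi> \<rho>"
  proof (rule differentiable_bound_general[OF \<rho>(2)])
    show "continuous_on {\<rho>..1} F"
    proof (intro continuous_at_imp_continuous_on ballI)
      fix t assume "t \<in> {\<rho>..1}"
      then show "isCont F t" using \<rho> by (intro has_vector_derivative_continuous[OF der]) auto
    qed
    show "continuous_on {\<rho>..1} \<Phi>"
      unfolding \<Phi>_def using \<alpha> by (intro continuous_intros continuous_on_powr') auto
    fix t assume t: "\<rho> < t" "t < 1"
    show "(F has_vector_derivative z *\<^sub>C complex_derivative f (t *\<^sub>R z)) (at t)"
      using der t \<rho> by simp
    have "((\<lambda>t. - (M / \<alpha>) * (1 - t) powr \<alpha>) has_real_derivative M * (1 - t) powr (\<alpha> - 1)) (at t)"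
      using t \<alpha> by (auto intro!: derivative_eq_intros simp: field_simps)
    then show "(\<Phi> has_vector_derivative M * (1 - t) powr (\<alpha> - 1)) (at t)"
      by (simp add: \<Phi>_def has_real_derivative_iff_has_vector_derivative)
    have "norm (complex_derivative f (t *\<^sub>R z)) \<le> M * (1 - t) powr (\<alpha> - 1)"
      using z t \<rho> mult_left_le[of "cmod z" t]
      by (intro derivative_growth_bound[OF g \<alpha>(2) tz]) auto
    then show "norm (z *\<^sub>C complex_derivative f (t *\<^sub>R z)) \<le> M * (1 - t) powr (\<alpha> - 1)"
      using z mult_left_le_one_le[of "norm (complex_derivative f (t *\<^sub>R z))" "cmod z"]
      by (simp add: norm_scaleC)
  qed
  then show ?thesis by (simp add: F_def \<Phi>_def)
qed

text \<open>The easy half of the Hardy--Littlewood theorem. With \<open>d = \<bar>z - w\<bar>\<close>, the path from \<open>z\<close> to \<open>w\<close>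
  goes radially inwards to modulus at most \<open>1 - d\<close>, across, and radially outwards again. The two
  radial pieces cost \<open>(M / \<alpha>) d^\<alpha>\<close> each; on the piece across the derivative is at most
  \<open>M d^(\<alpha> - 1)\<close> and the length at most \<open>d\<close>. For \<open>d \<ge> 1\<close> the path passes through the origin and the
  piece across is trivial.\<close>
lemma derivative_growth_imp_Hoelder:
  assumes f: "f \<in> analytic_disk" and g: "derivative_growth \<alpha> f M" and \<alpha>: "0 < \<alpha>" "\<alpha> \<le> 1"
    and z: "z \<in> \<bbbD>" and w: "w \<in> \<bbbD>"
  shows "norm (f z - f w) \<le> (2 / \<alpha> + 1) * M * cmod (z - w) powr \<alpha>"
proof (cases "cmod (z - w) = 0")
  case False
  define d where "d = cmod (z - w)"
  define \<rho> where "\<rho> = max 0 (1 - d)"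
  have d: "0 < d" using False by (simp add: d_def)
  have M: "0 \<le> M" by (rule derivative_growth_nonneg[OF g])
  have \<rho>: "0 \<le> \<rho>" "\<rho> < 1" "1 - \<rho> \<le> d" using d by (auto simp: \<rho>_def)
  have radial: "norm (f u - f (\<rho> *\<^sub>R u)) \<le> M / \<alpha> * d powr \<alpha>" if "u \<in> \<bbbD>" for u
  proof -
    have "norm (f u - f (\<rho> *\<^sub>R u)) \<le> M / \<alpha> * (1 - \<rho>) powr \<alpha>"
      by (rule radial_increment_le[OF f g \<alpha> that \<rho>(1,2)])
    also have "\<dots> \<le> M / \<alpha> * d powr \<alpha>"
      using \<alpha> M \<rho> by (intro mult_left_mono powr_mono2) auto
    finally show ?thesis .
  qed
  have middle: "norm (f (\<rho> *\<^sub>R z) - f (\<rho> *\<^sub>R w)) \<le> M * d powr \<alpha>"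
  proof (cases "d < 1")
    case True
    then have \<rho>d: "\<rho> = 1 - d" by (simp add: \<rho>_def)
    have sub: "cball 0 \<rho> \<subseteq> \<bbbD>" using \<rho> by auto
    have "norm (f (\<rho> *\<^sub>R z) - f (\<rho> *\<^sub>R w)) \<le> (M * d powr (\<alpha> - 1)) * cmod (\<rho> *\<^sub>R z - \<rho> *\<^sub>R w)"
    proof (rule analytic_disk_convex_bound[OF f _ sub])
      show "convex (cball (0::complex) \<rho>)" by simp
      show "\<rho> *\<^sub>R z \<in> cball 0 \<rho>" "\<rho> *\<^sub>R w \<in> cball 0 \<rho>"
        using z w \<rho> by (auto simp: mult_left_le)
      fix u :: complex assume "u \<in> cball 0 \<rho>"
      then show "norm (complex_derivative f u) \<le> M * d powr (\<alpha> - 1)"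
        using d \<rho>d sub by (intro derivative_growth_bound[OF g \<alpha>(2)]) auto
    qed
    also have "\<rho> *\<^sub>R z - \<rho> *\<^sub>R w = \<rho> *\<^sub>R (z - w)" by (simp add: scaleR_diff_right)
    also have "cmod \<dots> \<le> d"
      using \<rho> d by (simp add: d_def mult_left_le_one_le)
    also have "(M * d powr (\<alpha> - 1)) * d = M * d powr \<alpha>"
      using d by (simp add: powr_diff)
    finally show ?thesis using M by (simp add: mult_left_mono)
  next
    case False
    then show ?thesis using M by (simp add: \<rho>_def)
  qed
  have "f z - f w = ((f z - f (\<rho> *\<^sub>R z)) + (f (\<rho> *\<^sub>R z) - f (\<rho> *\<^sub>R w))) - (f w - f (\<rho> *\<^sub>R w))"
    by simp
  then have "norm (f z - f w) \<le> norm (f z - f (\<rho> *\<^sub>R z)) + norm (f (\<rho> *\<^sub>R z) - f (\<rho> *\<^sub>R w))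
      + norm (f w - f (\<rho> *\<^sub>R w))"
    by (simp only:) (rule order_trans[OF norm_triangle_ineq4 add_right_mono[OF norm_triangle_ineq]])
  also have "\<dots> \<le> M / \<alpha> * d powr \<alpha> + M * d powr \<alpha> + M / \<alpha> * d powr \<alpha>"
    using radial[OF z] radial[OF w] middle by linarith
  also have "\<dots> = (2 / \<alpha> + 1) * M * d powr \<alpha>" by (simp add: algebra_simps)
  finally show ?thesis by (simp add: d_def)
qed simp

text \<open>The scalar Cauchy inequality is applied to \<open>l \<circ> f\<close>, where the functional \<open>l\<close> of norm at most
  one attains the norm of the derivative of \<open>f\<close> at the centre of the circle.\<close>
lemma norm_complex_derivative_le_Cauchy:
  assumes f: "f \<in> analytic_disk" and r: "0 < r" "r < 1 - cmod z"
    and B: "\<And>w. cmod (z - w) = r \<Longrightarrow> norm (f w - f z) \<le> B"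
  shows "norm (complex_derivative f z) \<le> B / r"
proof -
  obtain l :: "'a \<Rightarrow> complex" where l: "bounded_linear l" "\<And>c x. l (c *\<^sub>C x) = c * l x"
    "\<And>x. cmod (l x) \<le> norm x" "cmod (l (complex_derivative f z)) = norm (complex_derivative f z)"
    using complex_norming_functional by blast
  define h where "h = (\<lambda>w. l (f w - f z))"
  have der: "(h has_field_derivative l (complex_derivative f w)) (at w)" if "w \<in> \<bbbD>" for w
  proof -
    have "((\<lambda>w. f w - f z) has_derivative (\<lambda>k. k *\<^sub>C complex_derivative f w)) (at w)"
      using analytic_disk_has_derivative[OF f that]
      by (auto simp: has_complex_derivative_def intro!: derivative_eq_intros)
    from bounded_linear.has_derivative[OF l(1) this] show ?thesis
      by (simp add: h_def has_field_derivative_def l(2) mult_commute_abs)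
  qed
  have sub: "cball z r \<subseteq> \<bbbD>"
  proof
    fix w assume "w \<in> cball z r"
    then show "w \<in> \<bbbD>" using r norm_triangle_sub[of w z] by (simp add: dist_norm norm_minus_commute)
  qed
  have hol: "h holomorphic_on \<bbbD>"
    using der unfolding holomorphic_on_open[OF open_ball] by blast
  have "cmod ((deriv ^^ 1) h z) \<le> fact 1 * B / r ^ 1"
  proof (rule Cauchy_inequality)
    show "h holomorphic_on ball z r"
      by (rule holomorphic_on_subset[OF hol]) (use sub ball_subset_cball in blast)
    show "continuous_on (cball z r) h"
      by (rule continuous_on_subset[OF holomorphic_on_imp_continuous_on[OF hol] sub])
    show "cmod (h w) \<le> B" if "cmod (z - w) = r" for w
      unfolding h_def using l(3) B[OF that] by (rule order_trans)
  qed (rule r)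
  moreover have "deriv h z = l (complex_derivative f z)"
    using der r by (intro DERIV_imp_deriv) auto
  ultimately show ?thesis using l(4) by simp
qed

text \<open>The converse half: on the circle about \<open>z\<close> of radius \<open>r = (1 - \<bar>z\<bar>) / 2\<close> the oscillation of \<open>f\<close>
  is at most \<open>p r^\<alpha>\<close>, so the derivative at \<open>z\<close> is at most \<open>p r^(\<alpha> - 1)\<close>, and \<open>1 - \<bar>z\<bar>^2 \<le> 4 r\<close>.\<close>
lemma Hoelder_imp_derivative_growth:
  assumes f: "f \<in> analytic_disk" and \<alpha>: "0 < \<alpha>" "\<alpha> \<le> 1"
    and p: "\<And>z w. z \<in> \<bbbD> \<Longrightarrow> w \<in> \<bbbD> \<Longrightarrow> norm (f z - f w) \<le> p * cmod (z - w) powr \<alpha>"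
  shows "derivative_growth \<alpha> f (4 * p)"
  unfolding derivative_growth_def
proof
  fix z assume z: "z \<in> \<bbbD>"
  define r where "r = (1 - cmod z) / 2"
  have r: "0 < r" "r < 1 - cmod z" using z by (auto simp: r_def)
  have "0 \<le> p * cmod (0 - 1 / 2) powr \<alpha>"
    by (rule order_trans[OF norm_ge_zero p]) auto
  then have p0: "0 \<le> p"
    by (simp add: zero_le_mult_iff)
  have "norm (complex_derivative f z) \<le> (p * r powr \<alpha>) / r"
  proof (rule norm_complex_derivative_le_Cauchy[OF f r])
    fix w assume w: "cmod (z - w) = r"
    then have "w \<in> \<bbbD>" using r norm_triangle_sub[of w z] by (simp add: norm_minus_commute)
    from p[OF this z] w show "norm (f w - f z) \<le> p * r powr \<alpha>" by (simp add: norm_minus_commute)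
  qed
  also have "\<dots> = p * r powr (\<alpha> - 1)" using r by (simp add: powr_diff)
  finally have 1: "norm (complex_derivative f z) \<le> p * r powr (\<alpha> - 1)" .
  have "(1 - (cmod z)\<^sup>2) powr (1 - \<alpha>) \<le> (4 * r) powr (1 - \<alpha>)"
    using one_minus_norm_sq[OF z] \<alpha> by (intro powr_mono2) (auto simp: r_def)
  also have "\<dots> = 4 powr (1 - \<alpha>) * r powr (1 - \<alpha>)" using r by (simp add: powr_mult)
  also have "\<dots> \<le> 4 powr 1 * r powr (1 - \<alpha>)"
    using \<alpha> by (intro mult_right_mono powr_mono) auto
  finally have 2: "(1 - (cmod z)\<^sup>2) powr (1 - \<alpha>) \<le> 4 * r powr (1 - \<alpha>)" by simp
  have "(1 - (cmod z)\<^sup>2) powr (1 - \<alpha>) * norm (complex_derivative f z)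
      \<le> (4 * r powr (1 - \<alpha>)) * (p * r powr (\<alpha> - 1))"
    by (rule mult_mono[OF 2 1]) auto
  also have "\<dots> = 4 * p * (r powr (1 - \<alpha>) * r powr (\<alpha> - 1))" by (simp add: algebra_simps)
  also have "r powr (1 - \<alpha>) * r powr (\<alpha> - 1) = 1" using r by (simp flip: powr_add)
  finally show "(1 - (cmod z)\<^sup>2) powr (1 - \<alpha>) * norm (complex_derivative f z) \<le> 4 * p" by simp
qed

lemma lip_seminorm_le_iff:
  assumes "0 \<le> p"
  shows "lip_seminorm \<alpha> f \<le> ennreal p \<longleftrightarrow>
    (\<forall>z\<in>\<bbbD>. \<forall>w\<in>\<bbbD>. norm (f z - f w) \<le> p * cmod (z - w) powr \<alpha>)"
proof -
  have "norm (f z - f w) / cmod (z - w) powr \<alpha> \<le> p \<longleftrightarrow> norm (f z - f w) \<le> p * cmod (z - w) powr \<alpha>"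
    if "z \<noteq> w" for z w
    using that by (simp add: pos_divide_le_eq)
  then show ?thesis
    using assms by (fastforce simp: lip_seminorm_def SUP_le_iff ennreal_le_iff)
qed

lemma SUP_disk_le_iff:
  assumes "0 \<le> M"
  shows "(SUP z\<in>\<bbbD>. ennreal (h z)) \<le> ennreal M \<longleftrightarrow> (\<forall>z\<in>\<bbbD>. h z \<le> M)"
  using assms by (simp add: SUP_le_iff ennreal_le_iff)

section \<open>The norm of the Lipschitz spaces\<close>

text \<open>This lemma and \<open>Lip_norm_leD\<close> replace the norm, which is defined differently for exponent 1, by one
  description that holds for all exponents: up to constants it is the sup norm together with the
  growth of the derivative.\<close>
lemma Lip_norm_le:
  assumes f: "f \<in> analytic_disk" and \<alpha>: "0 < \<alpha>" "\<alpha> \<le> 1"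
    and A: "\<And>z. z \<in> \<bbbD> \<Longrightarrow> norm (f z) \<le> A" and M: "derivative_growth \<alpha> f M"
  shows "Lip_norm \<alpha> f \<le> ennreal (A + (2 / \<alpha> + 1) * M)"
proof -
  have M0: "0 \<le> M" by (rule derivative_growth_nonneg[OF M])
  have A0: "0 \<le> A" using A[of 0] norm_ge_zero[of "f 0"] by (simp del: norm_ge_zero)
  show ?thesis
  proof (cases "\<alpha> < 1")
    case True
    have "Lip_norm \<alpha> f \<le> ennreal A + ennreal M"
      using A[of 0] M True A0 M0
      by (auto simp: Lip_norm_def SUP_disk_le_iff derivative_growth_def ennreal_leI intro!: add_mono)
    also have "\<dots> = ennreal (A + M)" using A0 M0 by simp
    also have "\<dots> \<le> ennreal (A + (2 / \<alpha> + 1) * M)"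
      using \<alpha> M0 by (intro ennreal_leI) (simp add: algebra_simps)
    finally show ?thesis .
  next
    case False
    have "lip_seminorm \<alpha> f \<le> ennreal ((2 / \<alpha> + 1) * M)"
      using \<alpha> M0 derivative_growth_imp_Hoelder[OF f M \<alpha>] by (subst lip_seminorm_le_iff) auto
    moreover have "(SUP z\<in>\<bbbD>. ennreal (norm (f z))) \<le> ennreal A"
      using A by (simp add: SUP_disk_le_iff[OF A0])
    ultimately have "Lip_norm \<alpha> f \<le> ennreal A + ennreal ((2 / \<alpha> + 1) * M)"
      using False by (simp add: Lip_norm_def add_mono)
    then show ?thesis using A0 M0 \<alpha> by (simp add: ennreal_plus)
  qed
qed

lemma ennreal_add_leD: "a + b \<le> c \<Longrightarrow> a \<le> c \<and> b \<le> (c::ennreal)"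
  by (metis add_increasing add_increasing2 order_refl order_trans zero_le)

lemma Lip_norm_leD:
  assumes f: "f \<in> analytic_disk" and \<alpha>: "0 < \<alpha>" "\<alpha> \<le> 1"
    and N: "Lip_norm \<alpha> f \<le> ennreal N" "0 \<le> N"
  shows "derivative_growth \<alpha> f (4 * N)" and "z \<in> \<bbbD> \<Longrightarrow> norm (f z) \<le> (1 + 1 / \<alpha>) * N"
proof -
  have "derivative_growth \<alpha> f (4 * N) \<and> (\<forall>z\<in>\<bbbD>. norm (f z) \<le> (1 + 1 / \<alpha>) * N)"
  proof (cases "\<alpha> < 1")
    case True
    have *: "ennreal (norm (f 0)) \<le> ennreal N"
      "(SUP z\<in>\<bbbD>. ennreal ((1 - (cmod z)\<^sup>2) powr (1 - \<alpha>) * norm (complex_derivative f z))) \<le> ennreal N"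
      using N(1) True
      by (auto simp: Lip_norm_def dest: ennreal_add_leD)
    then have f0: "norm (f 0) \<le> N" and g: "derivative_growth \<alpha> f N"
      using N(2) by (auto simp: derivative_growth_def SUP_disk_le_iff)
    have "norm (f z) \<le> (1 + 1 / \<alpha>) * N" if "z \<in> \<bbbD>" for z
      using radial_increment_le[OF f g \<alpha> that, of 0] f0 norm_triangle_sub[of "f z" "f 0"]
      by (simp add: algebra_simps)
    moreover have "derivative_growth \<alpha> f (4 * N)"
      by (rule derivative_growth_mono[OF g]) (use N(2) in simp)
    ultimately show ?thesis by blast
  next
    case False
    then have *: "(SUP z\<in>\<bbbD>. ennreal (norm (f z))) \<le> ennreal N" "lip_seminorm \<alpha> f \<le> ennreal N"
      using N(1)
      by (auto simp: Lip_norm_def dest: ennreal_add_leD)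
    have "derivative_growth \<alpha> f (4 * N)"
      using *(2) N(2) by (intro Hoelder_imp_derivative_growth[OF f \<alpha>]) (use lip_seminorm_le_iff[OF N(2), of \<alpha> f] in simp)
    moreover have "norm (f z) \<le> (1 + 1 / \<alpha>) * N" if "z \<in> \<bbbD>" for z
    proof -
      have "norm (f z) \<le> N" using *(1) that by (auto simp: SUP_disk_le_iff[OF N(2)])
      also have "\<dots> \<le> (1 + 1 / \<alpha>) * N" using \<alpha> N(2) by (simp add: algebra_simps)
      finally show ?thesis .
    qed
    ultimately show ?thesis by blast
  qed
  then show "derivative_growth \<alpha> f (4 * N)" and "z \<in> \<bbbD> \<Longrightarrow> norm (f z) \<le> (1 + 1 / \<alpha>) * N"
    by auto
qed

lemma Lip_iff_Lip_norm_finite: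
  assumes \<alpha>: "0 < \<alpha>" "\<alpha> \<le> 1"
  shows "f \<in> Lip \<alpha> \<longleftrightarrow> f \<in> analytic_disk \<and> Lip_norm \<alpha> f < \<infinity>"
proof (intro iffI conjI; (elim conjE)?)
  assume "f \<in> Lip \<alpha>"
  then show f: "f \<in> analytic_disk" by (simp add: Lip_def)
  from \<open>f \<in> Lip \<alpha>\<close> obtain p where p: "0 \<le> p" "lip_seminorm \<alpha> f = ennreal p"
    unfolding Lip_def by (cases "lip_seminorm \<alpha> f") auto
  then have H: "norm (f z - f w) \<le> p * cmod (z - w) powr \<alpha>" if "z \<in> \<bbbD>" "w \<in> \<bbbD>" for z w
    using lip_seminorm_le_iff[OF p(1), of \<alpha> f] that by simp
  have "norm (f z) \<le> norm (f 0) + p" if z: "z \<in> \<bbbD>" for z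
  proof -
    have "p * cmod z powr \<alpha> \<le> p"
      using z \<alpha> p(1) powr_mono2[of \<alpha> "cmod z" 1] by (simp add: mult_left_le)
    then show ?thesis using H[OF z, of 0] norm_triangle_sub[of "f z" "f 0"] by simp
  qed
  from Lip_norm_le[OF f \<alpha> this Hoelder_imp_derivative_growth[OF f \<alpha> H]]
  show "Lip_norm \<alpha> f < \<infinity>" by (rule le_less_trans) simp_all
next
  assume f: "f \<in> analytic_disk" and "Lip_norm \<alpha> f < \<infinity>"
  then obtain N where N: "0 \<le> N" "Lip_norm \<alpha> f = ennreal N"
    by (cases "Lip_norm \<alpha> f") auto
  have g: "derivative_growth \<alpha> f (4 * N)" using N by (intro Lip_norm_leD[OF f \<alpha>]) auto
  have "lip_seminorm \<alpha> f \<le> ennreal ((2 / \<alpha> + 1) * (4 * N))"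
    using N \<alpha> derivative_growth_imp_Hoelder[OF f g \<alpha>] by (subst lip_seminorm_le_iff) auto
  then have "lip_seminorm \<alpha> f < \<infinity>" by (rule le_less_trans) simp
  then show "f \<in> Lip \<alpha>" using f by (simp add: Lip_def)
qed

section \<open>Derivatives of weighted compositions\<close>

lemma bounded_bilinear_cblinfun_apply:
  "bounded_bilinear (cblinfun_apply :: ('a::complex_banach \<Rightarrow>\<^sub>C\<^sub>L 'b::complex_banach) \<Rightarrow> 'a \<Rightarrow> 'b)"
proof
  fix A B :: "'a \<Rightarrow>\<^sub>C\<^sub>L 'b" and x y :: 'a and r :: real
  show "cblinfun_apply (A + B) x = cblinfun_apply A x + cblinfun_apply B x"
    by transfer (simp add: blinfun.add_left)
  show "cblinfun_apply A (x + y) = cblinfun_apply A x + cblinfun_apply A y"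
    by transfer (simp add: blinfun.add_right)
  show "cblinfun_apply (r *\<^sub>R A) x = r *\<^sub>R cblinfun_apply A x"
    by transfer (simp add: blinfun.scaleR_left)
  show "cblinfun_apply A (r *\<^sub>R x) = r *\<^sub>R cblinfun_apply A x"
    by transfer (simp add: blinfun.scaleR_right)
  show "\<exists>K. \<forall>(A :: 'a \<Rightarrow>\<^sub>C\<^sub>L 'b) x. norm (cblinfun_apply A x) \<le> norm A * norm x * K"
    by (rule exI[of _ 1], transfer) (simp add: norm_blinfun)
qed

lemma norm_cblinfun_apply_le: "norm (cblinfun_apply A x) \<le> norm A * norm x"
  by transfer (rule norm_blinfun)

lemma cblinfun_apply_scaleC_right: "cblinfun_apply A (c *\<^sub>C x) = c *\<^sub>C cblinfun_apply A x"
  by transfer simp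

lemma cblinfun_apply_scaleC_left: "cblinfun_apply (c *\<^sub>C A) x = c *\<^sub>C cblinfun_apply A x"
  by transfer (rule apply_scaleC_blinfun)

lemma norm_cblinfun_leI:
  assumes B: "\<And>x. norm x \<le> 1 \<Longrightarrow> norm (cblinfun_apply A x) \<le> B"
  shows "norm A \<le> B"
proof -
  interpret bounded_bilinear cblinfun_apply by (rule bounded_bilinear_cblinfun_apply)
  have B0: "0 \<le> B" using B[of 0] by (simp add: zero_right)
  have "norm (cblinfun_apply A x) \<le> B * norm x" for x
  proof (cases "x = 0")
    case False
    then have "norm (cblinfun_apply A ((1 / norm x) *\<^sub>R x)) \<le> B" by (intro B) simp
    then show ?thesis using False by (simp add: scaleR_right divide_simps)
  qed (simp add: zero_right)
  then show ?thesis
    using B0 by transfer (rule norm_blinfun_bound)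
qed

lemma weighted_comp_has_complex_derivative:
  assumes \<psi>: "has_complex_derivative \<psi> \<psi>' z" and f: "has_complex_derivative f f' (\<phi> z)"
    and \<phi>: "(\<phi> has_field_derivative \<phi>') (at z)"
  shows "has_complex_derivative (weighted_comp \<psi> \<phi> f)
    (cblinfun_apply \<psi>' (f (\<phi> z)) + \<phi>' *\<^sub>C cblinfun_apply (\<psi> z) f') z"
proof -
  have "((\<lambda>w. f (\<phi> w)) has_derivative (\<lambda>h. (\<phi>' * h) *\<^sub>C f')) (at z)"
    using has_derivative_compose[of \<phi> "(*) \<phi>'" z UNIV f "\<lambda>h. h *\<^sub>C f'"] \<phi> f
    by (simp add: has_field_derivative_def has_complex_derivative_def)
  from bounded_bilinear.FDERIV[OF bounded_bilinear_cblinfun_apply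
      \<psi>[unfolded has_complex_derivative_def] this]
  have "((\<lambda>w. cblinfun_apply (\<psi> w) (f (\<phi> w))) has_derivative
     (\<lambda>h. cblinfun_apply (\<psi> z) ((\<phi>' * h) *\<^sub>C f') + cblinfun_apply (h *\<^sub>C \<psi>') (f (\<phi> z)))) (at z)" .
  moreover have "weighted_comp \<psi> \<phi> f = (\<lambda>w. cblinfun_apply (\<psi> w) (f (\<phi> w)))"
    by (simp add: weighted_comp_def fun_eq_iff)
  moreover have "cblinfun_apply (\<psi> z) ((\<phi>' * h) *\<^sub>C f') + cblinfun_apply (h *\<^sub>C \<psi>') (f (\<phi> z))
      = h *\<^sub>C (cblinfun_apply \<psi>' (f (\<phi> z)) + \<phi>' *\<^sub>C cblinfun_apply (\<psi> z) f')" for h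
    by (simp add: cblinfun_apply_scaleC_right cblinfun_apply_scaleC_left scaleC_add_right
        scaleC_scaleC mult.commute add.commute)
  ultimately show ?thesis by (simp add: has_complex_derivative_def)
qed

lemma weighted_comp_derivative:
  assumes \<phi>: "\<phi> holomorphic_on \<bbbD>" "\<phi> ` \<bbbD> \<subseteq> \<bbbD>"
    and \<psi>: "\<psi> \<in> analytic_disk" and f: "f \<in> analytic_disk" and z: "z \<in> \<bbbD>"
  shows "has_complex_derivative (weighted_comp \<psi> \<phi> f)
    (cblinfun_apply (complex_derivative \<psi> z) (f (\<phi> z))
      + deriv \<phi> z *\<^sub>C cblinfun_apply (\<psi> z) (complex_derivative f (\<phi> z))) z"
proof (rule weighted_comp_has_complex_derivative)
  have "\<phi> z \<in> \<bbbD>" using \<phi>(2) z by blast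
  then show "has_complex_derivative f (complex_derivative f (\<phi> z)) (\<phi> z)"
    by (rule analytic_disk_has_derivative[OF f])
  show "has_complex_derivative \<psi> (complex_derivative \<psi> z) z"
    by (rule analytic_disk_has_derivative[OF \<psi> z])
  show "(\<phi> has_field_derivative deriv \<phi> z) (at z)"
    using \<phi>(1) open_ball z by (rule holomorphic_derivI)
qed

lemma weighted_comp_analytic:
  assumes "\<phi> holomorphic_on \<bbbD>" "\<phi> ` \<bbbD> \<subseteq> \<bbbD>" "\<psi> \<in> analytic_disk" "f \<in> analytic_disk"
  shows "weighted_comp \<psi> \<phi> f \<in> analytic_disk"
  using weighted_comp_derivative[OF assms] by (rule analytic_diskI)

section \<open>Test functions\<close>

text \<open>A primitive of \<open>k z = (1 - cnj a z)^(\<alpha> - 1)\<close> has the largest derivative at \<open>a\<close> that the growth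
  condition permits, up to a constant: \<open>1 - cnj a a = 1 - \<bar>a\<bar>^2\<close>, whereas \<open>\<bar>1 - cnj a z\<bar> \<ge> 1 - \<bar>z\<bar>\<close>
  keeps \<open>k\<close> within the growth condition on the whole disk, uniformly in \<open>a\<close>.
  The constant of integration makes the function vanish at \<open>a\<close>; then the term of the product rule
  that contains the derivative of \<open>\<psi>\<close> disappears when the function is tested at \<open>\<phi> z = a\<close>.\<close>
lemma kernel_primitive_exists:
  assumes \<alpha>: "0 < \<alpha>" "\<alpha> \<le> 1" and a: "a \<in> \<bbbD>"
  shows "\<exists>g :: complex \<Rightarrow> complex. g \<in> analytic_disk \<and> g a = 0 \<and> derivative_growth \<alpha> g 2 \<and>
    complex_derivative g a = complex_of_real ((1 - (cmod a)\<^sup>2) powr (\<alpha> - 1))"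
proof -
  define k where "k = (\<lambda>z. (1 - cnj a * z) powr complex_of_real (\<alpha> - 1))"
  have prod: "cmod (cnj a * z) \<le> cmod z" if "z \<in> \<bbbD>" for z
    using a that by (simp add: norm_mult mult_left_le_one_le)
  have Re: "0 < Re (1 - cnj a * z)" if "z \<in> \<bbbD>" for z
  proof -
    have "Re (cnj a * z) \<le> cmod (cnj a * z)" by (rule complex_Re_le_cmod)
    also have "\<dots> < 1" using prod[OF that] that by simp
    finally show ?thesis by (simp only: minus_complex.sel one_complex.sel)
  qed
  have "k holomorphic_on \<bbbD>"
    unfolding k_def using Re
    by (intro holomorphic_intros) (metis complex_nonpos_Reals_iff less_le_not_le)
  from holomorphic_convex_primitive'[OF convex_ball open_ball this] obtain g
    where "\<And>z. z \<in> \<bbbD> \<Longrightarrow> (g has_field_derivative k z) (at z within \<bbbD>)" by blast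
  then have g: "(g has_field_derivative k z) (at z)" if "z \<in> \<bbbD>" for z
    using that by (metis at_within_open open_ball)
  define G where "G = (\<lambda>z. g z - g a)"
  have G: "has_complex_derivative G (k z) z" if "z \<in> \<bbbD>" for z
    unfolding has_complex_derivative_scalar_iff G_def
    using g[OF that] by (auto intro!: derivative_eq_intros)
  have norm_k: "cmod (k z) = cmod (1 - cnj a * z) powr (\<alpha> - 1)" for z
    by (simp add: k_def norm_powr_real_powr')
  have "derivative_growth \<alpha> G 2"
    unfolding derivative_growth_def
  proof
    fix z assume z: "z \<in> \<bbbD>"
    define s where "s = 1 - cmod z"
    have s: "0 < s" "1 - (cmod z)\<^sup>2 \<le> 2 * s" using one_minus_norm_sq[OF z] by (auto simp: s_def)
    have "s \<le> cmod (1 - cnj a * z)"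
      using prod[OF z] norm_triangle_ineq2[of 1 "cnj a * z"] by (simp add: s_def)
    then have 1: "cmod (k z) \<le> s powr (\<alpha> - 1)"
      unfolding norm_k using \<alpha> s by (intro powr_mono2') auto
    have "(1 - (cmod z)\<^sup>2) powr (1 - \<alpha>) \<le> (2 * s) powr (1 - \<alpha>)"
      using one_minus_norm_sq[OF z] s \<alpha> by (intro powr_mono2) auto
    also have "\<dots> = 2 powr (1 - \<alpha>) * s powr (1 - \<alpha>)" using s by (simp add: powr_mult)
    also have "\<dots> \<le> 2 powr 1 * s powr (1 - \<alpha>)"
      using \<alpha> by (intro mult_right_mono powr_mono) auto
    finally have 2: "(1 - (cmod z)\<^sup>2) powr (1 - \<alpha>) \<le> 2 * s powr (1 - \<alpha>)" by simp
    have "(1 - (cmod z)\<^sup>2) powr (1 - \<alpha>) * cmod (k z) \<le> (2 * s powr (1 - \<alpha>)) * s powr (\<alpha> - 1)"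
      by (rule mult_mono[OF 2 1]) auto
    also have "\<dots> = 2" using s by (simp flip: powr_add)
    finally show "(1 - (cmod z)\<^sup>2) powr (1 - \<alpha>) * norm (complex_derivative G z) \<le> 2"
      using complex_derivative_eqI[OF G[OF z]] by simp
  qed
  moreover have "k a = complex_of_real ((1 - (cmod a)\<^sup>2) powr (\<alpha> - 1))"
  proof -
    have "1 - cnj a * a = complex_of_real (1 - (cmod a)\<^sup>2)"
      using complex_norm_square[of a] by (simp add: mult.commute)
    then show ?thesis
      using one_minus_norm_sq(4)[OF a] unfolding k_def by (simp only: powr_of_real less_imp_le)
  qed
  moreover have "G \<in> analytic_disk" using G by (rule analytic_diskI)
  ultimately show ?thesis
    using complex_derivative_eqI[OF G[OF a]] by (intro exI[of _ G]) (simp add: G_def)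
qed

text \<open>Constants isolate \<open>\<psi>\<close>: the weighted composition of the constant \<open>x\<close> is \<open>z \<mapsto> \<psi>\<^sub>z x\<close>.\<close>
lemma constant_in_unit_ball:
  assumes \<alpha>: "0 < \<alpha>" "\<alpha> \<le> 1" and x: "norm x \<le> 1"
  shows "(\<lambda>_. x) \<in> analytic_disk" and "Lip_norm \<alpha> (\<lambda>_. x) \<le> 1"
proof -
  show A: "(\<lambda>_. x) \<in> analytic_disk"
    by (rule analytic_diskI) (rule has_complex_derivative_const)
  have "derivative_growth \<alpha> (\<lambda>_. x) 0"
    by (simp add: derivative_growth_def complex_derivative_eqI[OF has_complex_derivative_const])
  from Lip_norm_le[OF A \<alpha> x this] show "Lip_norm \<alpha> (\<lambda>_. x) \<le> 1" by simp
qed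

text \<open>The normalisation \<open>6 (2 / \<alpha> + 1)\<close> comes from the two parts of the norm. With \<open>c = 2 / \<alpha> + 1\<close>, the
  primitive above has Hoelder constant \<open>2 c\<close> and vanishes at \<open>a\<close>, so it is bounded by \<open>4 c\<close> on the
  disk, whose diameter is 2; its growth constant 2 contributes another \<open>2 c\<close> to the norm.\<close>
lemma peak_function_in_unit_ball:
  fixes x :: "'a::complex_banach"
  assumes \<alpha>: "0 < \<alpha>" "\<alpha> \<le> 1" and a: "a \<in> \<bbbD>" and x: "norm x \<le> 1"
  shows "\<exists>f. f \<in> analytic_disk \<and> Lip_norm \<alpha> f \<le> 1 \<and> f a = 0 \<and>
    complex_derivative f a = ((1 - (cmod a)\<^sup>2) powr (\<alpha> - 1) / (6 * (2 / \<alpha> + 1))) *\<^sub>R x"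
proof -
  define c where "c = 2 / \<alpha> + 1"
  have c: "0 < c" using \<alpha> by (simp add: c_def add_pos_pos)
  obtain g :: "complex \<Rightarrow> complex" where g: "g \<in> analytic_disk" "g a = 0" "derivative_growth \<alpha> g 2"
    "complex_derivative g a = complex_of_real ((1 - (cmod a)\<^sup>2) powr (\<alpha> - 1))"
    using kernel_primitive_exists[OF \<alpha> a] by blast
  define y where "y = (1 / (6 * c)) *\<^sub>R x"
  have y: "norm y \<le> 1 / (6 * c)" using x c by (simp add: y_def divide_simps)
  define f where "f = (\<lambda>z. g z *\<^sub>C y)"
  have D: "has_complex_derivative f (complex_derivative g z *\<^sub>C y) z" if "z \<in> \<bbbD>" for z
  proof -
    have "(g has_derivative (\<lambda>h. h *\<^sub>C complex_derivative g z)) (at z)"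
      using analytic_disk_has_derivative[OF g(1) that] by (simp add: has_complex_derivative_def)
    from bounded_linear.has_derivative[OF bounded_linear_scaleC_left[of y] this]
    show ?thesis by (simp add: has_complex_derivative_def f_def scaleC_complex_def scaleC_scaleC)
  qed
  have f: "f \<in> analytic_disk" using D by (rule analytic_diskI)
  have sup: "norm (f z) \<le> 4 * c * (1 / (6 * c))" if z: "z \<in> \<bbbD>" for z
  proof -
    have "cmod (z - a) \<le> 2" using z a norm_triangle_ineq4[of z a] by simp
    then have "cmod (z - a) powr \<alpha> \<le> 2 powr \<alpha>" using \<alpha> by (intro powr_mono2) auto
    also have "\<dots> \<le> 2 powr 1" using \<alpha> by (intro powr_mono) auto
    finally have "c * 2 * cmod (z - a) powr \<alpha> \<le> c * 2 * 2"
      using c by (intro mult_left_mono) auto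
    moreover have "cmod (g z) \<le> c * 2 * cmod (z - a) powr \<alpha>"
      using derivative_growth_imp_Hoelder[OF g(1,3) \<alpha> z a] g(2) by (simp add: c_def)
    ultimately have "cmod (g z) \<le> 4 * c" by simp
    then show ?thesis
      unfolding f_def norm_scaleC using y c by (intro mult_mono) auto
  qed
  have growth: "derivative_growth \<alpha> f (2 * (1 / (6 * c)))"
    unfolding derivative_growth_def
  proof
    fix z assume z: "z \<in> \<bbbD>"
    have "((1 - (cmod z)\<^sup>2) powr (1 - \<alpha>) * cmod (complex_derivative g z)) * norm y \<le> 2 * (1 / (6 * c))"
      using g(3) y z by (intro mult_mono) (auto simp: derivative_growth_def)
    then show "(1 - (cmod z)\<^sup>2) powr (1 - \<alpha>) * norm (complex_derivative f z) \<le> 2 * (1 / (6 * c))"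
      by (simp add: complex_derivative_eqI[OF D[OF z]] norm_scaleC mult.assoc)
  qed
  have "4 * c * (1 / (6 * c)) + (2 / \<alpha> + 1) * (2 * (1 / (6 * c))) = 1"
    unfolding c_def[symmetric] using c by (simp add: field_simps)
  with Lip_norm_le[OF f \<alpha> sup growth] have "Lip_norm \<alpha> f \<le> 1" by simp
  moreover have "complex_derivative f a = ((1 - (cmod a)\<^sup>2) powr (\<alpha> - 1) / (6 * c)) *\<^sub>R x"
    using complex_derivative_eqI[OF D[OF a]] by (simp add: g(4) y_def flip: scaleR_scaleC)
  moreover have "f a = 0"
    using g(2) by (simp add: f_def scaleC_0_left)
  ultimately show ?thesis using f unfolding c_def by blast
qed

section \<open>Boundedness of weighted composition operators\<close>

text \<open>Operator norms are recovered from the test functions by letting \<open>x\<close> range over the unit ball of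
  the domain: constants give the bounds on \<open>\<psi>\<close> and its derivative, and the function that peaks at
  \<open>\<phi> z\<close> gives the bound on the weighted size of \<open>\<phi>' z\<close> and \<open>\<psi>\<^sub>z\<close>.\<close>
lemma weighted_comp_bounded_imp:
  fixes \<psi> :: "complex \<Rightarrow> ('a::complex_banach \<Rightarrow>\<^sub>C\<^sub>L 'b::complex_banach)"
  assumes \<alpha>: "0 < \<alpha>" "\<alpha> \<le> 1" and \<beta>: "0 < \<beta>" "\<beta> \<le> 1"
    and \<phi>: "\<phi> holomorphic_on \<bbbD>" "\<phi> ` \<bbbD> \<subseteq> \<bbbD>" and \<psi>: "\<psi> \<in> analytic_disk"
    and T: "0 \<le> T" and W: "\<And>f. f \<in> analytic_disk \<Longrightarrow> Lip_norm \<alpha> f \<le> 1 \<Longrightarrow>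
      Lip_norm \<beta> (weighted_comp \<psi> \<phi> f) \<le> ennreal T"
  shows "Lip_norm \<beta> \<psi> \<le> ennreal ((1 + 1 / \<beta> + (2 / \<beta> + 1) * 4) * T)"
    and "q_quantity \<alpha> \<beta> \<psi> \<phi> \<le> ennreal (24 * (2 / \<alpha> + 1) * T)"
proof -
  have WD: "derivative_growth \<beta> (weighted_comp \<psi> \<phi> f) (4 * T)"
    "\<And>z. z \<in> \<bbbD> \<Longrightarrow> norm (weighted_comp \<psi> \<phi> f z) \<le> (1 + 1 / \<beta>) * T"
    if "f \<in> analytic_disk" "Lip_norm \<alpha> f \<le> 1" for f
    using Lip_norm_leD[OF weighted_comp_analytic[OF \<phi> \<psi> that(1)] \<beta> W[OF that] T] by auto
  have sup: "norm (\<psi> z) \<le> (1 + 1 / \<beta>) * T" if z: "z \<in> \<bbbD>" for z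
  proof (rule norm_cblinfun_leI)
    fix x :: 'a assume "norm x \<le> 1"
    from WD(2)[OF constant_in_unit_ball[OF \<alpha> this] z]
    show "norm (cblinfun_apply (\<psi> z) x) \<le> (1 + 1 / \<beta>) * T" by (simp add: weighted_comp_def)
  qed
  have growth: "derivative_growth \<beta> \<psi> (4 * T)"
    unfolding derivative_growth_def
  proof
    fix z assume z: "z \<in> \<bbbD>"
    define w where "w = (1 - (cmod z)\<^sup>2) powr (1 - \<beta>)"
    have w: "0 < w" using one_minus_norm_sq(4)[OF z] by (simp add: w_def)
    have "norm (complex_derivative \<psi> z) \<le> 4 * T / w"
    proof (rule norm_cblinfun_leI)
      fix x :: 'a assume x: "norm x \<le> 1"
      note c = constant_in_unit_ball[OF \<alpha> x]
      have "complex_derivative (\<lambda>_::complex. x) (\<phi> z) = 0"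
        by (rule complex_derivative_eqI) (rule has_complex_derivative_const)
      with complex_derivative_eqI[OF weighted_comp_derivative[OF \<phi> \<psi> c(1) z]]
      have "complex_derivative (weighted_comp \<psi> \<phi> (\<lambda>_. x)) z = cblinfun_apply (complex_derivative \<psi> z) x"
        by (simp add: bounded_bilinear.zero_right[OF bounded_bilinear_cblinfun_apply]
            scaleC_0_right)
      with WD(1)[OF c] z have "w * norm (cblinfun_apply (complex_derivative \<psi> z) x) \<le> 4 * T"
        unfolding derivative_growth_def w_def by metis
      then show "norm (cblinfun_apply (complex_derivative \<psi> z) x) \<le> 4 * T / w"
        using w by (simp add: pos_le_divide_eq mult.commute)
    qed
    then show "w * norm (complex_derivative \<psi> z) \<le> 4 * T"
      using w by (simp add: pos_le_divide_eq mult.commute)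
  qed
  have "Lip_norm \<beta> \<psi> \<le> ennreal ((1 + 1 / \<beta>) * T + (2 / \<beta> + 1) * (4 * T))"
    by (rule Lip_norm_le[OF \<psi> \<beta> sup growth])
  then show "Lip_norm \<beta> \<psi> \<le> ennreal ((1 + 1 / \<beta> + (2 / \<beta> + 1) * 4) * T)"
    by (simp add: algebra_simps)
  \<comment> \<open>the normalising factor of the peaking functions\<close>
  define c where "c = 6 * (2 / \<alpha> + 1)"
  have c: "0 < c" using \<alpha> by (simp add: c_def add_pos_pos)
  have "(1 - (cmod z)\<^sup>2) powr (1 - \<beta>) / (1 - (cmod (\<phi> z))\<^sup>2) powr (1 - \<alpha>)
      * cmod (deriv \<phi> z) * norm (\<psi> z) \<le> 4 * c * T" if z: "z \<in> \<bbbD>" for z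
  proof -
    have \<phi>z: "\<phi> z \<in> \<bbbD>" using \<phi>(2) z by blast
    define w where "w = (1 - (cmod z)\<^sup>2) powr (1 - \<beta>)"
    define v where "v = (1 - (cmod (\<phi> z))\<^sup>2) powr (\<alpha> - 1)"
    define d where "d = cmod (deriv \<phi> z)"
    have w: "0 < w" using one_minus_norm_sq(4)[OF z] by (simp add: w_def)
    have v: "0 < v" using one_minus_norm_sq(4)[OF \<phi>z] by (simp add: v_def)
    have v': "(1 - (cmod (\<phi> z))\<^sup>2) powr (1 - \<alpha>) = 1 / v"
      unfolding v_def by (simp flip: powr_minus_divide)
    have "w * v * d * norm (\<psi> z) \<le> 4 * c * T"
    proof (cases "d = 0")
      case True
      then show ?thesis using c T by simp
    next
      case False
      then have d: "0 < d" by (simp add: d_def)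
      have "norm (\<psi> z) \<le> 4 * c * T / (w * v * d)"
      proof (rule norm_cblinfun_leI)
        fix x :: 'a assume "norm x \<le> 1"
        from peak_function_in_unit_ball[OF \<alpha> \<phi>z this]
        obtain f where f: "f \<in> analytic_disk" "Lip_norm \<alpha> f \<le> 1" "f (\<phi> z) = 0"
          "complex_derivative f (\<phi> z) = (v / c) *\<^sub>R x"
          unfolding v_def c_def by blast
        have "complex_derivative (weighted_comp \<psi> \<phi> f) z
            = deriv \<phi> z *\<^sub>C (v / c) *\<^sub>R cblinfun_apply (\<psi> z) x"
          using complex_derivative_eqI[OF weighted_comp_derivative[OF \<phi> \<psi> f(1) z]]
          by (simp add: f(3,4) bounded_bilinear.zero_right[OF bounded_bilinear_cblinfun_apply]
              bounded_bilinear.scaleR_right[OF bounded_bilinear_cblinfun_apply])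
        then have "norm (complex_derivative (weighted_comp \<psi> \<phi> f) z)
            = d * (v / c) * norm (cblinfun_apply (\<psi> z) x)"
          using v c by (simp add: norm_scaleC d_def)
        with WD(1)[OF f(1,2)] z have "w * (d * (v / c) * norm (cblinfun_apply (\<psi> z) x)) \<le> 4 * T"
          unfolding derivative_growth_def w_def by metis
        then show "norm (cblinfun_apply (\<psi> z) x) \<le> 4 * c * T / (w * v * d)"
          using w v d c by (simp add: field_simps)
      qed
      then show ?thesis using w v d by (simp add: field_simps)
    qed
    then show ?thesis by (simp add: v' w_def d_def)
  qed
  then have "q_quantity \<alpha> \<beta> \<psi> \<phi> \<le> ennreal (4 * c * T)"
    using c T by (simp add: q_quantity_def SUP_disk_le_iff)
  then show "q_quantity \<alpha> \<beta> \<psi> \<phi> \<le> ennreal (24 * (2 / \<alpha> + 1) * T)"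
    by (simp add: c_def mult.assoc)
qed

text \<open>In the product rule the first term \<open>\<psi>'(z) (f (\<phi> z))\<close> is controlled by the norm of \<open>\<psi>\<close> and the
  sup norm of \<open>f\<close>. The second term is split as the expression whose supremum is \<open>q\<close>, times the
  weighted derivative of \<open>f\<close> at \<open>\<phi> z\<close>.\<close>
lemma weighted_comp_Lip_norm_le:
  assumes \<alpha>: "0 < \<alpha>" "\<alpha> \<le> 1" and \<beta>: "0 < \<beta>" "\<beta> \<le> 1"
    and \<phi>: "\<phi> holomorphic_on \<bbbD>" "\<phi> ` \<bbbD> \<subseteq> \<bbbD>" and \<psi>: "\<psi> \<in> analytic_disk"
    and P: "0 \<le> P" "Lip_norm \<beta> \<psi> \<le> ennreal P" "q_quantity \<alpha> \<beta> \<psi> \<phi> \<le> ennreal P"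
    and f: "f \<in> analytic_disk" and N: "0 \<le> N" "Lip_norm \<alpha> f \<le> ennreal N"
  shows "Lip_norm \<beta> (weighted_comp \<psi> \<phi> f)
    \<le> ennreal (((1 + 1 / \<beta>) * (1 + 1 / \<alpha>) + (2 / \<beta> + 1) * (4 * (1 + 1 / \<alpha>) + 4)) * P * N)"
proof -
  define A where "A = 1 + 1 / \<alpha>"
  define B where "B = 1 + 1 / \<beta>"
  have A: "0 < A" and B: "0 < B" using \<alpha> \<beta> by (auto simp: A_def B_def add_pos_pos)
  have \<phi>z: "\<phi> z \<in> \<bbbD>" if "z \<in> \<bbbD>" for z using \<phi>(2) that by blast
  have f': "derivative_growth \<alpha> f (4 * N)" and fs: "\<And>z. z \<in> \<bbbD> \<Longrightarrow> norm (f z) \<le> A * N"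
    using Lip_norm_leD[OF f \<alpha> N(2,1)] by (auto simp: A_def)
  have \<psi>': "derivative_growth \<beta> \<psi> (4 * P)" and \<psi>s: "\<And>z. z \<in> \<bbbD> \<Longrightarrow> norm (\<psi> z) \<le> B * P"
    using Lip_norm_leD[OF \<psi> \<beta> P(2,1)] by (auto simp: B_def)
  have sup: "norm (weighted_comp \<psi> \<phi> f z) \<le> B * P * (A * N)" if z: "z \<in> \<bbbD>" for z
    unfolding weighted_comp_def
    by (rule order_trans[OF norm_cblinfun_apply_le mult_mono[OF \<psi>s[OF z] fs[OF \<phi>z[OF z]]]])
      (use B P(1) in auto)
  have growth: "derivative_growth \<beta> (weighted_comp \<psi> \<phi> f) (4 * P * (A * N) + P * (4 * N))"
    unfolding derivative_growth_def
  proof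
    fix z assume z: "z \<in> \<bbbD>"
    define w where "w = (1 - (cmod z)\<^sup>2) powr (1 - \<beta>)"
    define v where "v = (1 - (cmod (\<phi> z))\<^sup>2) powr (1 - \<alpha>)"
    define d where "d = cmod (deriv \<phi> z)"
    have v: "0 < v" using one_minus_norm_sq(4)[OF \<phi>z[OF z]] by (simp add: v_def)
    have "norm (complex_derivative (weighted_comp \<psi> \<phi> f) z)
        \<le> norm (complex_derivative \<psi> z) * norm (f (\<phi> z))
          + d * (norm (\<psi> z) * norm (complex_derivative f (\<phi> z)))"
      unfolding complex_derivative_eqI[OF weighted_comp_derivative[OF \<phi> \<psi> f z]] d_def
      by (rule order_trans[OF norm_triangle_ineq add_mono])
        (auto simp: norm_scaleC intro!: norm_cblinfun_apply_le mult_left_mono)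
    then have "w * norm (complex_derivative (weighted_comp \<psi> \<phi> f) z)
        \<le> w * (norm (complex_derivative \<psi> z) * norm (f (\<phi> z))
          + d * (norm (\<psi> z) * norm (complex_derivative f (\<phi> z))))"
      by (rule mult_left_mono) (simp add: w_def)
    also have "\<dots> = (w * norm (complex_derivative \<psi> z)) * norm (f (\<phi> z))
          + (w / v * d * norm (\<psi> z)) * (v * norm (complex_derivative f (\<phi> z)))"
      using v by (simp add: field_simps)
    also have "\<dots> \<le> 4 * P * (A * N) + P * (4 * N)"
    proof (rule add_mono[OF mult_mono mult_mono])
      show "w * norm (complex_derivative \<psi> z) \<le> 4 * P"
        using \<psi>' z by (auto simp: derivative_growth_def w_def)
      show "norm (f (\<phi> z)) \<le> A * N" by (rule fs[OF \<phi>z[OF z]])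
      show "w / v * d * norm (\<psi> z) \<le> P"
        using P(3) z unfolding q_quantity_def SUP_disk_le_iff[OF P(1)] w_def v_def d_def by blast
      show "v * norm (complex_derivative f (\<phi> z)) \<le> 4 * N"
        using f' \<phi>z[OF z] by (auto simp: derivative_growth_def v_def)
    qed (use A P(1) N(1) v in \<open>auto simp: w_def\<close>)
    finally show "w * norm (complex_derivative (weighted_comp \<psi> \<phi> f) z)
        \<le> 4 * P * (A * N) + P * (4 * N)" .
  qed
  from Lip_norm_le[OF weighted_comp_analytic[OF \<phi> \<psi> f] \<beta> sup growth]
  have "Lip_norm \<beta> (weighted_comp \<psi> \<phi> f)
    \<le> ennreal (B * P * (A * N) + (2 / \<beta> + 1) * (4 * P * (A * N) + P * (4 * N)))" .
  also have "B * P * (A * N) + (2 / \<beta> + 1) * (4 * P * (A * N) + P * (4 * N))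
      = (B * A + (2 / \<beta> + 1) * (4 * A + 4)) * P * N"
    by (simp add: algebra_simps)
  finally show ?thesis by (simp add: A_def B_def)
qed

lemma weighted_comp_maps_boundedly_imp:
  fixes \<psi> :: "complex \<Rightarrow> ('a::complex_banach \<Rightarrow>\<^sub>C\<^sub>L 'b::complex_banach)"
  assumes \<alpha>: "0 < \<alpha>" "\<alpha> \<le> 1" and \<beta>: "0 < \<beta>" "\<beta> \<le> 1"
    and \<phi>: "\<phi> holomorphic_on \<bbbD>" "\<phi> ` \<bbbD> \<subseteq> \<bbbD>" and \<psi>: "\<psi> \<in> analytic_disk"
    and W: "maps_Lip_boundedly \<alpha> \<beta> (weighted_comp \<psi> \<phi>)"
  shows "Lip_opnorm \<alpha> \<beta> (weighted_comp \<psi> \<phi>) < \<infinity>"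
    and "max (q_quantity \<alpha> \<beta> \<psi> \<phi>) (Lip_norm \<beta> \<psi>)
      \<le> ennreal (24 * (2 / \<alpha> + 1) + (1 + 1 / \<beta> + (2 / \<beta> + 1) * 4))
        * Lip_opnorm \<alpha> \<beta> (weighted_comp \<psi> \<phi>)"
proof -
  let ?W = "weighted_comp \<psi> \<phi>"
  obtain C where C: "0 \<le> C" "\<And>f. f \<in> Lip \<alpha> \<Longrightarrow> Lip_norm \<beta> (?W f) \<le> ennreal C * Lip_norm \<alpha> f"
    using W unfolding maps_Lip_boundedly_def by blast
  have "Lip_opnorm \<alpha> \<beta> ?W \<le> ennreal C"
    unfolding Lip_opnorm_def
  proof (rule SUP_least, clarify)
    fix f :: "complex \<Rightarrow> 'a" assume f: "f \<in> Lip \<alpha>" "Lip_norm \<alpha> f \<le> 1"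
    have "ennreal C * Lip_norm \<alpha> f \<le> ennreal C * 1" by (rule mult_left_mono[OF f(2)]) simp
    with C(2)[OF f(1)] show "Lip_norm \<beta> (?W f) \<le> ennreal C" by simp
  qed
  then show fin: "Lip_opnorm \<alpha> \<beta> ?W < \<infinity>" by (rule le_less_trans) simp
  then obtain T where T: "0 \<le> T" "Lip_opnorm \<alpha> \<beta> ?W = ennreal T"
    by (cases "Lip_opnorm \<alpha> \<beta> ?W") auto
  have bound: "Lip_norm \<beta> (?W f) \<le> ennreal T" if f: "f \<in> analytic_disk" "Lip_norm \<alpha> f \<le> 1" for f
  proof -
    have "Lip_norm \<alpha> f < \<infinity>" using f(2) by (rule le_less_trans) simp
    then have "f \<in> {f \<in> Lip \<alpha>. Lip_norm \<alpha> f \<le> 1}"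
      using f by (simp add: Lip_iff_Lip_norm_finite[OF \<alpha>])
    then show ?thesis unfolding T(2)[symmetric] Lip_opnorm_def by (rule SUP_upper)
  qed
  define b1 where "b1 = 24 * (2 / \<alpha> + 1)"
  define b2 where "b2 = 1 + 1 / \<beta> + (2 / \<beta> + 1) * 4"
  have b: "0 \<le> b1" "0 \<le> b2" using \<alpha> \<beta> by (auto simp: b1_def b2_def)
  note * = weighted_comp_bounded_imp[OF \<alpha> \<beta> \<phi> \<psi> T(1) bound]
  have "q_quantity \<alpha> \<beta> \<psi> \<phi> \<le> ennreal (b1 * T)" "Lip_norm \<beta> \<psi> \<le> ennreal (b2 * T)"
    using * by (simp_all add: b1_def b2_def)
  moreover have "b1 * T \<le> (b1 + b2) * T" "b2 * T \<le> (b1 + b2) * T"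
    using b T(1) by (auto intro!: mult_right_mono)
  ultimately have "max (q_quantity \<alpha> \<beta> \<psi> \<phi>) (Lip_norm \<beta> \<psi>) \<le> ennreal ((b1 + b2) * T)"
    by (meson ennreal_leI max.boundedI order_trans)
  also have "\<dots> = ennreal (b1 + b2) * Lip_opnorm \<alpha> \<beta> ?W"
    using b T by (simp add: ennreal_mult)
  finally show "max (q_quantity \<alpha> \<beta> \<psi> \<phi>) (Lip_norm \<beta> \<psi>)
      \<le> ennreal (24 * (2 / \<alpha> + 1) + (1 + 1 / \<beta> + (2 / \<beta> + 1) * 4)) * Lip_opnorm \<alpha> \<beta> ?W"
    by (simp add: b1_def b2_def)
qed

lemma weighted_comp_maps_boundedly:
  fixes \<psi> :: "complex \<Rightarrow> ('a::complex_banach \<Rightarrow>\<^sub>C\<^sub>L 'b::complex_banach)"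
  assumes \<alpha>: "0 < \<alpha>" "\<alpha> \<le> 1" and \<beta>: "0 < \<beta>" "\<beta> \<le> 1"
    and \<phi>: "\<phi> holomorphic_on \<bbbD>" "\<phi> ` \<bbbD> \<subseteq> \<bbbD>" and \<psi>: "\<psi> \<in> analytic_disk"
    and fin: "max (q_quantity \<alpha> \<beta> \<psi> \<phi>) (Lip_norm \<beta> \<psi>) < \<infinity>"
  shows "maps_Lip_boundedly \<alpha> \<beta> (weighted_comp \<psi> \<phi>)"
    and "Lip_opnorm \<alpha> \<beta> (weighted_comp \<psi> \<phi>)
      \<le> ennreal ((1 + 1 / \<beta>) * (1 + 1 / \<alpha>) + (2 / \<beta> + 1) * (4 * (1 + 1 / \<alpha>) + 4))
        * max (q_quantity \<alpha> \<beta> \<psi> \<phi>) (Lip_norm \<beta> \<psi>)"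
proof -
  let ?W = "weighted_comp \<psi> \<phi>" and ?m = "max (q_quantity \<alpha> \<beta> \<psi> \<phi>) (Lip_norm \<beta> \<psi>)"
  define K where "K = (1 + 1 / \<beta>) * (1 + 1 / \<alpha>) + (2 / \<beta> + 1) * (4 * (1 + 1 / \<alpha>) + 4)"
  have K: "0 \<le> K" using \<alpha> \<beta> by (simp add: K_def)
  obtain P where P: "0 \<le> P" "?m = ennreal P"
    using fin by (cases ?m) auto
  have P': "Lip_norm \<beta> \<psi> \<le> ennreal P" "q_quantity \<alpha> \<beta> \<psi> \<phi> \<le> ennreal P"
    unfolding P(2)[symmetric] by simp_all
  have main: "?W f \<in> Lip \<beta>" "Lip_norm \<beta> (?W f) \<le> ennreal (K * P) * Lip_norm \<alpha> f"
    if "f \<in> Lip \<alpha>" for f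
  proof -
    have f: "f \<in> analytic_disk" "Lip_norm \<alpha> f < \<infinity>"
      using that Lip_iff_Lip_norm_finite[OF \<alpha>] by auto
    then obtain N where N: "0 \<le> N" "Lip_norm \<alpha> f = ennreal N"
      by (cases "Lip_norm \<alpha> f") auto
    have le: "Lip_norm \<beta> (?W f) \<le> ennreal (K * P * N)"
      unfolding K_def
      by (rule weighted_comp_Lip_norm_le[OF \<alpha> \<beta> \<phi> \<psi> P(1) P' f(1) N(1)]) (simp add: N(2))
    then show "Lip_norm \<beta> (?W f) \<le> ennreal (K * P) * Lip_norm \<alpha> f"
      using K P(1) N by (simp add: ennreal_mult)
    have "Lip_norm \<beta> (?W f) < \<infinity>" using le by (rule le_less_trans) simp
    then show "?W f \<in> Lip \<beta>"
      using weighted_comp_analytic[OF \<phi> \<psi> f(1)] by (simp add: Lip_iff_Lip_norm_finite[OF \<beta>])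
  qed
  then show "maps_Lip_boundedly \<alpha> \<beta> ?W"
    unfolding maps_Lip_boundedly_def using K P(1) by (blast intro: mult_nonneg_nonneg)
  have "Lip_opnorm \<alpha> \<beta> ?W \<le> ennreal (K * P)"
    unfolding Lip_opnorm_def
  proof (rule SUP_least, clarify)
    fix f :: "complex \<Rightarrow> 'a" assume f: "f \<in> Lip \<alpha>" "Lip_norm \<alpha> f \<le> 1"
    have "ennreal (K * P) * Lip_norm \<alpha> f \<le> ennreal (K * P) * 1"
      by (rule mult_left_mono[OF f(2)]) simp
    with main(2)[OF f(1)] show "Lip_norm \<beta> (?W f) \<le> ennreal (K * P)" by simp
  qed
  also have "\<dots> = ennreal K * ?m" using K P by (simp add: ennreal_mult)
  finally show "Lip_opnorm \<alpha> \<beta> ?W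
      \<le> ennreal ((1 + 1 / \<beta>) * (1 + 1 / \<alpha>) + (2 / \<beta> + 1) * (4 * (1 + 1 / \<alpha>) + 4)) * ?m"
    by (simp add: K_def)
qed

theorem theorem2p3:
  fixes \<alpha> \<beta> :: real
  assumes "0 < \<alpha>" and "\<alpha> < 1" and "0 < \<beta>" and "\<beta> \<le> 1"
  shows
    "(\<forall>(\<phi> :: complex \<Rightarrow> complex) (\<psi> :: complex \<Rightarrow> ('a::complex_banach \<Rightarrow>\<^sub>C\<^sub>L 'b::complex_banach)).
        \<phi> holomorphic_on \<bbbD> \<and> \<phi> ` \<bbbD> \<subseteq> \<bbbD> \<and> \<psi> \<in> analytic_disk \<longrightarrow>
        (maps_Lip_boundedly \<alpha> \<beta> (weighted_comp \<psi> \<phi>) \<longleftrightarrow>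
           \<psi> \<in> Lip \<beta> \<and> q_quantity \<alpha> \<beta> \<psi> \<phi> < \<infinity>)) \<and>
     (\<exists>a b :: real. a > 0 \<and> b > 0 \<and>
        (\<forall>(\<phi> :: complex \<Rightarrow> complex) (\<psi> :: complex \<Rightarrow> ('a \<Rightarrow>\<^sub>C\<^sub>L 'b)).
           \<phi> holomorphic_on \<bbbD> \<and> \<phi> ` \<bbbD> \<subseteq> \<bbbD> \<and> \<psi> \<in> analytic_disk \<and>
           maps_Lip_boundedly \<alpha> \<beta> (weighted_comp \<psi> \<phi>) \<longrightarrow>
           ennreal a * Lip_opnorm \<alpha> \<beta> (weighted_comp \<psi> \<phi>)
             \<le> max (q_quantity \<alpha> \<beta> \<psi> \<phi>) (Lip_norm \<beta> \<psi>) \<and>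
           max (q_quantity \<alpha> \<beta> \<psi> \<phi>) (Lip_norm \<beta> \<psi>)
             \<le> ennreal b * Lip_opnorm \<alpha> \<beta> (weighted_comp \<psi> \<phi>)))"
proof -
  have \<alpha>: "0 < \<alpha>" "\<alpha> \<le> 1" and \<beta>: "0 < \<beta>" "\<beta> \<le> 1" using assms by auto
  define K where "K = (1 + 1 / \<beta>) * (1 + 1 / \<alpha>) + (2 / \<beta> + 1) * (4 * (1 + 1 / \<alpha>) + 4)"
  define b where "b = 24 * (2 / \<alpha> + 1) + (1 + 1 / \<beta> + (2 / \<beta> + 1) * 4)"
  have K: "0 < K" unfolding K_def using \<alpha> \<beta> by (intro add_pos_pos mult_pos_pos) auto
  have b: "0 < b" unfolding b_def using \<alpha> \<beta> by (intro add_pos_pos mult_pos_pos) auto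
  have finite: "max (q_quantity \<alpha> \<beta> \<psi> \<phi>) (Lip_norm \<beta> \<psi>) < \<infinity>"
    if "\<phi> holomorphic_on \<bbbD>" "\<phi> ` \<bbbD> \<subseteq> \<bbbD>" "\<psi> \<in> analytic_disk"
      "maps_Lip_boundedly \<alpha> \<beta> (weighted_comp \<psi> \<phi>)"
    for \<phi> and \<psi> :: "complex \<Rightarrow> ('a \<Rightarrow>\<^sub>C\<^sub>L 'b)"
  proof -
    note * = weighted_comp_maps_boundedly_imp[OF \<alpha> \<beta> that, folded b_def]
    have "ennreal b * Lip_opnorm \<alpha> \<beta> (weighted_comp \<psi> \<phi>) < \<infinity>"
      using *(1) by (simp add: ennreal_mult_less_top)
    with *(2) show ?thesis by (rule le_less_trans)
  qed
  show ?thesis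
  proof (rule conjI[OF _ exI[of _ "1 / K", OF exI[of _ b]]]; intro conjI allI impI; (elim conjE)?)
    fix \<phi> :: "complex \<Rightarrow> complex" and \<psi> :: "complex \<Rightarrow> ('a \<Rightarrow>\<^sub>C\<^sub>L 'b)"
    assume \<phi>: "\<phi> holomorphic_on \<bbbD>" "\<phi> ` \<bbbD> \<subseteq> \<bbbD>" and \<psi>: "\<psi> \<in> analytic_disk"
    show "maps_Lip_boundedly \<alpha> \<beta> (weighted_comp \<psi> \<phi>) \<longleftrightarrow> \<psi> \<in> Lip \<beta> \<and> q_quantity \<alpha> \<beta> \<psi> \<phi> < \<infinity>"
      using finite[OF \<phi> \<psi>] weighted_comp_maps_boundedly(1)[OF \<alpha> \<beta> \<phi> \<psi>] \<psi>
        Lip_iff_Lip_norm_finite[OF \<beta>, of \<psi>]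
      unfolding max_less_iff_conj by blast
  next
    fix \<phi> :: "complex \<Rightarrow> complex" and \<psi> :: "complex \<Rightarrow> ('a \<Rightarrow>\<^sub>C\<^sub>L 'b)"
    let ?m = "max (q_quantity \<alpha> \<beta> \<psi> \<phi>) (Lip_norm \<beta> \<psi>)"
      and ?n = "Lip_opnorm \<alpha> \<beta> (weighted_comp \<psi> \<phi>)"
    assume *: "\<phi> holomorphic_on \<bbbD>" "\<phi> ` \<bbbD> \<subseteq> \<bbbD>" "\<psi> \<in> analytic_disk"
      "maps_Lip_boundedly \<alpha> \<beta> (weighted_comp \<psi> \<phi>)"
    have "ennreal (1 / K) * ?n \<le> ennreal (1 / K) * (ennreal K * ?m)"
      using weighted_comp_maps_boundedly(2)[OF \<alpha> \<beta> *(1-3) finite[OF *], folded K_def]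
      by (rule mult_left_mono) simp
    also have "\<dots> = ?m"
      using K by (simp add: mult.assoc[symmetric] ennreal_mult[symmetric])
    finally show "ennreal (1 / K) * ?n \<le> ?m" .
    show "?m \<le> ennreal b * ?n"
      unfolding b_def by (rule weighted_comp_maps_boundedly_imp(2)[OF \<alpha> \<beta> *])
  qed (use K b in simp_all)
qed

end
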